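(* Let $L$ be a Lie algebra over a field $\mathbb{F}$ such that $L/L^2$ is finite dimensional. Then $$L\otimes L\;\cong\; (L\wedge L)\oplus (L\,\square\, L)$$ (as Lie algebras).
   Context: Lie algebras are over a fixed field $\mathbb{F}$, not necessarily finite dimensional. $L^2=[L,L]$ denotes the derived subalgebra of $L$. The (nonabelian) tensor square $L\otimes L$ of $L$ is the Lie algebra over $\mathbb{F}$ generated by symbols $l\otimes k$ ($l,k\in L$) subject to the relations, for all $c\in\mathbb{F}$ and $l,l',k,k'\in L$: (i) $c(l\otimes k)=cl\otimes k=l\otimes ck$; (ii) $(l+l')\otimes k=l\otimes k+l'\otimes k$ and $l\otimes(k+k')=l\otimes k+l\otimes k'$; (iii) $[l,l']\otimes k=l\otimes[l',k]-l'\otimes[l,k]$ and $l\otimes[k,k']=[k',l]\otimes k-[k,l]\otimes k'$; (iv) $[\,l\otimes k,\;l'\otimes k'\,]=-[k,l]\otimes[l',k']$. $L\,\square\, L$ is the submodule of $L\otimes L$ generated by all elements $l\otimes l$, $l\in L$ (it is an ideal). The exterior square of $L$ is the quotient $L\wedge L=(L\otimes L)/(L\,\square\, L)$, and $l\wedge l'$ denotes the coset of $l\otimes l'$. *)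

theory Defs
  imports "HOL-Algebra.Module" "HOL-Algebra.QuotRing" "HOL-Algebra.Chinese_Remainder"
begin

section \<open>Lie algebras as module records\<close>

text \<open>
  A (not necessarily associative) algebra is a \<^type>\<open>module_ext\<close> record whose \<^const>\<open>mult\<close> field
  is its product; for a Lie algebra this is the bracket. As for \<^locale>\<open>module\<close>, the field
  \<^const>\<open>one\<close> carries no meaning.
\<close>

abbreviation (input) lie_bracket :: "[('a, 'm) monoid_scheme, 'a, 'a] \<Rightarrow> 'a"
    (\<open>\<lblot>_,/ _\<rblot>\<index>\<close>)
  where "lie_bracket L x y \<equiv> x \<otimes>\<^bsub>L\<^esub> y"

locale lie_algebra = F?: field F + L?: module F L
  for F (structure) and L (structure) +
  assumes bracket_closed [simp, intro]:
      "\<lbrakk>x \<in> carrier L; y \<in> carrier L\<rbrakk> \<Longrightarrow> \<lblot>x, y\<rblot>\<^bsub>L\<^esub> \<in> carrier L"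
    and bracket_add_left:
      "\<lbrakk>x \<in> carrier L; y \<in> carrier L; z \<in> carrier L\<rbrakk> \<Longrightarrow>
        \<lblot>x \<oplus>\<^bsub>L\<^esub> y, z\<rblot>\<^bsub>L\<^esub> = \<lblot>x, z\<rblot>\<^bsub>L\<^esub> \<oplus>\<^bsub>L\<^esub> \<lblot>y, z\<rblot>\<^bsub>L\<^esub>"
    and bracket_add_right:
      "\<lbrakk>x \<in> carrier L; y \<in> carrier L; z \<in> carrier L\<rbrakk> \<Longrightarrow>
        \<lblot>x, y \<oplus>\<^bsub>L\<^esub> z\<rblot>\<^bsub>L\<^esub> = \<lblot>x, y\<rblot>\<^bsub>L\<^esub> \<oplus>\<^bsub>L\<^esub> \<lblot>x, z\<rblot>\<^bsub>L\<^esub>"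
    and bracket_smult_left:
      "\<lbrakk>c \<in> carrier F; x \<in> carrier L; y \<in> carrier L\<rbrakk> \<Longrightarrow>
        \<lblot>c \<odot>\<^bsub>L\<^esub> x, y\<rblot>\<^bsub>L\<^esub> = c \<odot>\<^bsub>L\<^esub> \<lblot>x, y\<rblot>\<^bsub>L\<^esub>"
    and bracket_smult_right:
      "\<lbrakk>c \<in> carrier F; x \<in> carrier L; y \<in> carrier L\<rbrakk> \<Longrightarrow>
        \<lblot>x, c \<odot>\<^bsub>L\<^esub> y\<rblot>\<^bsub>L\<^esub> = c \<odot>\<^bsub>L\<^esub> \<lblot>x, y\<rblot>\<^bsub>L\<^esub>"
    and bracket_self:
      "x \<in> carrier L \<Longrightarrow> \<lblot>x, x\<rblot>\<^bsub>L\<^esub> = \<zero>\<^bsub>L\<^esub>"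
    and jacobi:
      "\<lbrakk>x \<in> carrier L; y \<in> carrier L; z \<in> carrier L\<rbrakk> \<Longrightarrow>
        \<lblot>x, \<lblot>y, z\<rblot>\<^bsub>L\<^esub>\<rblot>\<^bsub>L\<^esub> \<oplus>\<^bsub>L\<^esub> \<lblot>y, \<lblot>z, x\<rblot>\<^bsub>L\<^esub>\<rblot>\<^bsub>L\<^esub> \<oplus>\<^bsub>L\<^esub> \<lblot>z, \<lblot>x, y\<rblot>\<^bsub>L\<^esub>\<rblot>\<^bsub>L\<^esub> = \<zero>\<^bsub>L\<^esub>"

definition lie_iso ::
    "[('a, 'm) ring_scheme, ('a, 'b, 'n) module_scheme, ('a, 'c, 'k) module_scheme] \<Rightarrow> ('b \<Rightarrow> 'c) set"
  where "lie_iso F M N =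
    {h. bij_betw h (carrier M) (carrier N)
      \<and> (\<forall>x\<in>carrier M. \<forall>y\<in>carrier M. h (x \<oplus>\<^bsub>M\<^esub> y) = h x \<oplus>\<^bsub>N\<^esub> h y)
      \<and> (\<forall>c\<in>carrier F. \<forall>x\<in>carrier M. h (c \<odot>\<^bsub>M\<^esub> x) = c \<odot>\<^bsub>N\<^esub> h x)
      \<and> (\<forall>x\<in>carrier M. \<forall>y\<in>carrier M. h \<lblot>x, y\<rblot>\<^bsub>M\<^esub> = \<lblot>h x, h y\<rblot>\<^bsub>N\<^esub>)}"

definition lie_isomorphic ::
    "[('a, 'm) ring_scheme, ('a, 'b, 'n) module_scheme, ('a, 'c, 'k) module_scheme] \<Rightarrow> bool"
  where "lie_isomorphic F M N \<longleftrightarrow> lie_iso F M N \<noteq> {}"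

definition lie_dirsum ::
    "[('a, 'b, 'n) module_scheme, ('a, 'c, 'k) module_scheme] \<Rightarrow> ('a, 'b \<times> 'c) module"
  where "lie_dirsum M N =
    ring.extend (RDirProd M N) (module.fields (\<lambda>c (x, y). (c \<odot>\<^bsub>M\<^esub> x, c \<odot>\<^bsub>N\<^esub> y)))"


section \<open>Generated submodules and ideals, quotients, dimension\<close>

definition module_span ::
    "[('a, 'm) ring_scheme, ('a, 'b, 'n) module_scheme, 'b set] \<Rightarrow> 'b set"
  where "module_span F M S = \<Inter>{H. submodule H F M \<and> S \<subseteq> H}"

definition alg_ideal ::
    "[('a, 'm) ring_scheme, ('a, 'b, 'n) module_scheme, 'b set] \<Rightarrow> bool"
  where "alg_ideal F A I \<longleftrightarrow>
    submodule I F A \<and> (\<forall>x\<in>carrier A. \<forall>y\<in>I. x \<otimes>\<^bsub>A\<^esub> y \<in> I \<and> y \<otimes>\<^bsub>A\<^esub> x \<in> I)"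

definition gen_ideal ::
    "[('a, 'm) ring_scheme, ('a, 'b, 'n) module_scheme, 'b set] \<Rightarrow> 'b set"
  where "gen_ideal F A S = \<Inter>{I. alg_ideal F A I \<and> S \<subseteq> I}"

definition alg_quot :: "[('a, 'b, 'n) module_scheme, 'b set] \<Rightarrow> ('a, 'b set) module"
  where "alg_quot A I =
    ring.extend (A Quot I) (module.fields (\<lambda>c C. \<Union>x\<in>C. I +>\<^bsub>A\<^esub> (c \<odot>\<^bsub>A\<^esub> x)))"

definition fin_dim :: "[('a, 'm) ring_scheme, ('a, 'b, 'n) module_scheme] \<Rightarrow> bool"
  where "fin_dim F V \<longleftrightarrow>
    (\<exists>B. finite B \<and> B \<subseteq> carrier V \<and> module_span F V B = carrier V
      \<and> (\<forall>a\<in>B \<rightarrow> carrier F. (\<Oplus>\<^bsub>V\<^esub>b\<in>B. a b \<odot>\<^bsub>V\<^esub> b) = \<zero>\<^bsub>V\<^esub> \<longrightarrow> (\<forall>b\<in>B. a b = \<zero>\<^bsub>F\<^esub>)))"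

definition derived_subalgebra ::
    "[('a, 'm) ring_scheme, ('a, 'b, 'n) module_scheme] \<Rightarrow> 'b set"
  where "derived_subalgebra F L =
    module_span F L {\<lblot>x, y\<rblot>\<^bsub>L\<^esub> | x y. x \<in> carrier L \<and> y \<in> carrier L}"


section \<open>Lie algebras given by generators and relations\<close>

datatype 'x magma = Gen 'x | Prod "'x magma" "'x magma"

text \<open>
  The free nonassociative algebra on a set \<open>S\<close> has the bracketed words in \<open>S\<close> as a basis;
  an element is given by its coefficient function. Since a word is a product of two words in at
  most one way, a coefficient of a product is a single product of coefficients.
\<close>

definition free_alg :: "[('a, 'm) ring_scheme, 'x set] \<Rightarrow> ('a, 'x magma \<Rightarrow> 'a) module"
  where "free_alg F S =
    \<lparr> carrier = {f. (\<forall>w. f w \<in> carrier F) \<and> finite {w. f w \<noteq> \<zero>\<^bsub>F\<^esub>}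
                  \<and> (\<forall>w. f w \<noteq> \<zero>\<^bsub>F\<^esub> \<longrightarrow> set_magma w \<subseteq> S)},
      mult = (\<lambda>f g w. case w of Gen x \<Rightarrow> \<zero>\<^bsub>F\<^esub> | Prod u v \<Rightarrow> f u \<otimes>\<^bsub>F\<^esub> g v),
      one = undefined,
      zero = (\<lambda>w. \<zero>\<^bsub>F\<^esub>),
      add = (\<lambda>f g w. f w \<oplus>\<^bsub>F\<^esub> g w),
      smult = (\<lambda>c f w. c \<otimes>\<^bsub>F\<^esub> f w) \<rparr>"

definition free_gen :: "[('a, 'm) ring_scheme, 'x] \<Rightarrow> 'x magma \<Rightarrow> 'a"
  where "free_gen F x = (\<lambda>w. if w = Gen x then \<one>\<^bsub>F\<^esub> else \<zero>\<^bsub>F\<^esub>)"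

definition lie_identities ::
    "('a, 'b, 'n) module_scheme \<Rightarrow> 'b set"
  where "lie_identities A =
    {\<lblot>x, x\<rblot>\<^bsub>A\<^esub> | x. x \<in> carrier A}
    \<union> {\<lblot>x, \<lblot>y, z\<rblot>\<^bsub>A\<^esub>\<rblot>\<^bsub>A\<^esub> \<oplus>\<^bsub>A\<^esub> \<lblot>y, \<lblot>z, x\<rblot>\<^bsub>A\<^esub>\<rblot>\<^bsub>A\<^esub> \<oplus>\<^bsub>A\<^esub> \<lblot>z, \<lblot>x, y\<rblot>\<^bsub>A\<^esub>\<rblot>\<^bsub>A\<^esub> | x y z.
        x \<in> carrier A \<and> y \<in> carrier A \<and> z \<in> carrier A}"

text \<open>A pair \<open>(u, v)\<close> in \<open>E\<close> stands for the defining relation \<open>u = v\<close>.\<close>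

definition presentation_ideal ::
    "[('a, 'm) ring_scheme, 'x set, (('x magma \<Rightarrow> 'a) \<times> ('x magma \<Rightarrow> 'a)) set]
      \<Rightarrow> ('x magma \<Rightarrow> 'a) set"
  where "presentation_ideal F S E =
    gen_ideal F (free_alg F S)
      (lie_identities (free_alg F S) \<union> {u \<ominus>\<^bsub>free_alg F S\<^esub> v | u v. (u, v) \<in> E})"

definition presented_lie_algebra ::
    "[('a, 'm) ring_scheme, 'x set, (('x magma \<Rightarrow> 'a) \<times> ('x magma \<Rightarrow> 'a)) set]
      \<Rightarrow> ('a, ('x magma \<Rightarrow> 'a) set) module"
  where "presented_lie_algebra F S E = alg_quot (free_alg F S) (presentation_ideal F S E)"


section \<open>The nonabelian tensor square and the exterior square\<close>

definition tensor_relations ::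
    "[('a, 'm) ring_scheme, ('a, 'b, 'n) module_scheme]
      \<Rightarrow> ((('b \<times> 'b) magma \<Rightarrow> 'a) \<times> (('b \<times> 'b) magma \<Rightarrow> 'a)) set"
  where "tensor_relations F L =
    (let A = free_alg F (carrier L \<times> carrier L);
         t = (\<lambda>l k. free_gen F (l, k))
     in {(c \<odot>\<^bsub>A\<^esub> t l k, t (c \<odot>\<^bsub>L\<^esub> l) k) | c l k.
            c \<in> carrier F \<and> l \<in> carrier L \<and> k \<in> carrier L}
      \<union> {(c \<odot>\<^bsub>A\<^esub> t l k, t l (c \<odot>\<^bsub>L\<^esub> k)) | c l k.
            c \<in> carrier F \<and> l \<in> carrier L \<and> k \<in> carrier L}
      \<union> {(t (l \<oplus>\<^bsub>L\<^esub> l') k, t l k \<oplus>\<^bsub>A\<^esub> t l' k) | l l' k.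
            l \<in> carrier L \<and> l' \<in> carrier L \<and> k \<in> carrier L}
      \<union> {(t l (k \<oplus>\<^bsub>L\<^esub> k'), t l k \<oplus>\<^bsub>A\<^esub> t l k') | l k k'.
            l \<in> carrier L \<and> k \<in> carrier L \<and> k' \<in> carrier L}
      \<union> {(t \<lblot>l, l'\<rblot>\<^bsub>L\<^esub> k, t l \<lblot>l', k\<rblot>\<^bsub>L\<^esub> \<ominus>\<^bsub>A\<^esub> t l' \<lblot>l, k\<rblot>\<^bsub>L\<^esub>) | l l' k.
            l \<in> carrier L \<and> l' \<in> carrier L \<and> k \<in> carrier L}
      \<union> {(t l \<lblot>k, k'\<rblot>\<^bsub>L\<^esub>, t \<lblot>k', l\<rblot>\<^bsub>L\<^esub> k \<ominus>\<^bsub>A\<^esub> t \<lblot>k, l\<rblot>\<^bsub>L\<^esub> k') | l k k'.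
            l \<in> carrier L \<and> k \<in> carrier L \<and> k' \<in> carrier L}
      \<union> {(\<lblot>t l k, t l' k'\<rblot>\<^bsub>A\<^esub>, \<ominus>\<^bsub>A\<^esub> t \<lblot>k, l\<rblot>\<^bsub>L\<^esub> \<lblot>l', k'\<rblot>\<^bsub>L\<^esub>) | l k l' k'.
            l \<in> carrier L \<and> k \<in> carrier L \<and> l' \<in> carrier L \<and> k' \<in> carrier L})"

definition tensor_square ::
    "[('a, 'm) ring_scheme, ('a, 'b, 'n) module_scheme]
      \<Rightarrow> ('a, (('b \<times> 'b) magma \<Rightarrow> 'a) set) module"
  where "tensor_square F L =
    presented_lie_algebra F (carrier L \<times> carrier L) (tensor_relations F L)"

definition tensor ::
    "[('a, 'm) ring_scheme, ('a, 'b, 'n) module_scheme, 'b, 'b] \<Rightarrow> (('b \<times> 'b) magma \<Rightarrow> 'a) set"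
  where "tensor F L l k =
    presentation_ideal F (carrier L \<times> carrier L) (tensor_relations F L)
      +>\<^bsub>free_alg F (carrier L \<times> carrier L)\<^esub> free_gen F (l, k)"

definition square_ideal ::
    "[('a, 'm) ring_scheme, ('a, 'b, 'n) module_scheme] \<Rightarrow> (('b \<times> 'b) magma \<Rightarrow> 'a) set set"
  where "square_ideal F L =
    module_span F (tensor_square F L) {tensor F L l l | l. l \<in> carrier L}"

definition exterior_square ::
    "[('a, 'm) ring_scheme, ('a, 'b, 'n) module_scheme]
      \<Rightarrow> ('a, (('b \<times> 'b) magma \<Rightarrow> 'a) set set) module"
  where "exterior_square F L = alg_quot (tensor_square F L) (square_ideal F L)"

end

theory Submission
  imports Defs
begin

text \<open>
  The ideal \<open>L \<box> L\<close> is central, so it suffices to find a linear retraction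
  \<open>L \<otimes> L \<rightarrow> L \<box> L\<close> that vanishes on brackets. The crossed relations make the quadratic
  map \<open>l \<mapsto> l \<otimes> l\<close> depend only on the class of \<open>l\<close> modulo \<open>L\<^sup>2\<close>. As \<open>L / L\<^sup>2\<close> is finite
  dimensional, there is a bilinear map \<open>B\<close> with values in \<open>L \<box> L\<close> that kills \<open>L\<^sup>2\<close> in both
  arguments and satisfies \<open>B l l = l \<otimes> l\<close>: adjoin a finite set of generators to \<open>L\<^sup>2\<close> one at a
  time. The defining relations of \<open>L \<otimes> L\<close> hold trivially for \<open>B\<close>, which therefore induces the
  retraction.
\<close>

section \<open>Linear maps and submodules\<close>

text \<open>Two facts make the diagonal insensitive to L^2. By relation (iv), [k, l] \<otimes>
  [k, l] is the bracket of l \<otimes> k with itself, hence zero. By relations (iii), the polar form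
  l \<otimes> k + k \<otimes> l vanishes as soon as one argument is a bracket, and the polar form is
  exactly the cross term in the diagonal of a sum. The shape of B answers two obstacles. The tensor
  map itself is not a candidate: off the diagonal it need not take values in the span of the
  squares; only its polar form must. Half of the polar form would serve, but not in characteristic
  2. So B is triangular instead of symmetric: when a generator is adjoined, the whole cross term
  goes to one side. The retraction has to kill brackets because its target is central: a Lie
  homomorphism onto an abelian algebra can do nothing else.\<close>

definition lin_maps ::
    "[('a, 'm) ring_scheme, ('a, 'b, 'n) module_scheme, ('a, 'c, 'k) module_scheme] \<Rightarrow> ('b \<Rightarrow> 'c) set"
  where "lin_maps F M N =
    {h. h \<in> carrier M \<rightarrow> carrier N
      \<and> (\<forall>x\<in>carrier M. \<forall>y\<in>carrier M. h (x \<oplus>\<^bsub>M\<^esub> y) = h x \<oplus>\<^bsub>N\<^esub> h y)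
      \<and> (\<forall>c\<in>carrier F. \<forall>x\<in>carrier M. h (c \<odot>\<^bsub>M\<^esub> x) = c \<odot>\<^bsub>N\<^esub> h x)}"

lemma lin_mapsD:
  assumes "h \<in> lin_maps F M N"
  shows "x \<in> carrier M \<Longrightarrow> h x \<in> carrier N"
    and "\<lbrakk>x \<in> carrier M; y \<in> carrier M\<rbrakk> \<Longrightarrow> h (x \<oplus>\<^bsub>M\<^esub> y) = h x \<oplus>\<^bsub>N\<^esub> h y"
    and "\<lbrakk>c \<in> carrier F; x \<in> carrier M\<rbrakk> \<Longrightarrow> h (c \<odot>\<^bsub>M\<^esub> x) = c \<odot>\<^bsub>N\<^esub> h x"
  using assms by (auto simp: lin_maps_def)

lemma lin_maps_zero:
  assumes "module F M" "module F N" "h \<in> lin_maps F M N"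
  shows "h \<zero>\<^bsub>M\<^esub> = \<zero>\<^bsub>N\<^esub>"
proof -
  interpret M: module F M by fact
  interpret N: module F N by fact
  show ?thesis
    using lin_mapsD(3)[OF assms(3), of "\<zero>\<^bsub>F\<^esub>" "\<zero>\<^bsub>M\<^esub>"] lin_mapsD(1)[OF assms(3)] by simp
qed

lemma lin_maps_minus:
  assumes "module F M" "module F N" "h \<in> lin_maps F M N" "x \<in> carrier M"
  shows "h (\<ominus>\<^bsub>M\<^esub> x) = \<ominus>\<^bsub>N\<^esub> h x"
proof -
  interpret M: module F M by fact
  interpret N: module F N by fact
  have "h (\<ominus>\<^bsub>M\<^esub> x) = h ((\<ominus>\<^bsub>F\<^esub> \<one>\<^bsub>F\<^esub>) \<odot>\<^bsub>M\<^esub> x)"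
    using assms(4) by (simp add: M.smult_l_minus)
  then show ?thesis
    using assms(4) lin_mapsD[OF assms(3)] by (simp add: N.smult_l_minus)
qed

lemma lin_maps_diff:
  assumes "module F M" "module F N" "h \<in> lin_maps F M N" "x \<in> carrier M" "y \<in> carrier M"
  shows "h (x \<ominus>\<^bsub>M\<^esub> y) = h x \<ominus>\<^bsub>N\<^esub> h y"
proof -
  interpret M: module F M by fact
  show ?thesis
    using assms lin_mapsD(2)[OF assms(3)] by (simp add: a_minus_def lin_maps_minus)
qed

context module
begin

lemma submodule_zero: "submodule H R M \<Longrightarrow> \<zero>\<^bsub>M\<^esub> \<in> H"
  using submodule.axioms(1)[of H R M] subgroup.one_closed[of H "add_monoid M"] by simp

lemma submodule_diff:
  "\<lbrakk>submodule H R M; x \<in> H; y \<in> H\<rbrakk> \<Longrightarrow> x \<ominus>\<^bsub>M\<^esub> y \<in> H"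
  by (simp add: a_minus_def submoduleE)

lemma submoduleI':
  assumes "H \<subseteq> carrier M" "\<zero>\<^bsub>M\<^esub> \<in> H"
    and "\<And>a b. \<lbrakk>a \<in> H; b \<in> H\<rbrakk> \<Longrightarrow> a \<oplus>\<^bsub>M\<^esub> b \<in> H"
    and "\<And>a x. \<lbrakk>a \<in> carrier R; x \<in> H\<rbrakk> \<Longrightarrow> a \<odot>\<^bsub>M\<^esub> x \<in> H"
  shows "submodule H R M"
proof (rule submoduleI)
  show "\<ominus>\<^bsub>M\<^esub> a \<in> H" if "a \<in> H" for a
    using assms(4)[of "\<ominus> \<one>" a] that assms(1) by (auto simp: smult_l_minus)
qed (use assms in auto)

lemma submodule_Inter:
  assumes "\<And>H. H \<in> \<H> \<Longrightarrow> submodule H R M" "\<H> \<noteq> {}"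
  shows "submodule (\<Inter>\<H>) R M"
proof (rule submoduleI')
  show "\<Inter>\<H> \<subseteq> carrier M"
    using assms submoduleE(1) by blast
qed (use submodule_zero[OF assms(1)] submoduleE(4,5)[OF assms(1)] in auto)

lemma module_span_submodule: "S \<subseteq> carrier M \<Longrightarrow> submodule (module_span R M S) R M"
  unfolding module_span_def using carrier_is_submodule by (intro submodule_Inter) auto

lemma module_span_least: "\<lbrakk>submodule H R M; S \<subseteq> H\<rbrakk> \<Longrightarrow> module_span R M S \<subseteq> H"
  unfolding module_span_def by blast

lemma module_span_incl: "S \<subseteq> module_span R M S"
  unfolding module_span_def by blast

lemma add_diff_cancel: "\<lbrakk>x \<in> carrier M; y \<in> carrier M\<rbrakk> \<Longrightarrow> (x \<oplus>\<^bsub>M\<^esub> y) \<ominus>\<^bsub>M\<^esub> x = y"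
  by (simp add: a_minus_def M.a_comm[of x y] M.a_assoc M.r_neg)

lemma diff_eq_zero_iff:
  "\<lbrakk>x \<in> carrier M; y \<in> carrier M\<rbrakk> \<Longrightarrow> x \<ominus>\<^bsub>M\<^esub> y = \<zero>\<^bsub>M\<^esub> \<longleftrightarrow> x = y"
  by (simp add: M.add.inv_solve_right' a_minus_def)

end


section \<open>Nonassociative algebras and their quotients\<close>

text \<open>Covers the free algebra, in which no Lie law is imposed, as well as Lie algebras, so
  that ideals and quotients are developed once for L/L^2, for presented algebras and for the
  exterior square.\<close>

locale nonassoc_algebra = F?: field F + A?: module F A
  for F (structure) and A (structure) +
  assumes prod_closed [simp, intro]:
      "\<lbrakk>x \<in> carrier A; y \<in> carrier A\<rbrakk> \<Longrightarrow> x \<otimes>\<^bsub>A\<^esub> y \<in> carrier A"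
    and prod_add_left:
      "\<lbrakk>x \<in> carrier A; y \<in> carrier A; z \<in> carrier A\<rbrakk> \<Longrightarrow>
        (x \<oplus>\<^bsub>A\<^esub> y) \<otimes>\<^bsub>A\<^esub> z = x \<otimes>\<^bsub>A\<^esub> z \<oplus>\<^bsub>A\<^esub> y \<otimes>\<^bsub>A\<^esub> z"
    and prod_add_right:
      "\<lbrakk>x \<in> carrier A; y \<in> carrier A; z \<in> carrier A\<rbrakk> \<Longrightarrow>
        x \<otimes>\<^bsub>A\<^esub> (y \<oplus>\<^bsub>A\<^esub> z) = x \<otimes>\<^bsub>A\<^esub> y \<oplus>\<^bsub>A\<^esub> x \<otimes>\<^bsub>A\<^esub> z"
    and prod_smult_left:
      "\<lbrakk>c \<in> carrier F; x \<in> carrier A; y \<in> carrier A\<rbrakk> \<Longrightarrow>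
        (c \<odot>\<^bsub>A\<^esub> x) \<otimes>\<^bsub>A\<^esub> y = c \<odot>\<^bsub>A\<^esub> (x \<otimes>\<^bsub>A\<^esub> y)"
    and prod_smult_right:
      "\<lbrakk>c \<in> carrier F; x \<in> carrier A; y \<in> carrier A\<rbrakk> \<Longrightarrow>
        x \<otimes>\<^bsub>A\<^esub> (c \<odot>\<^bsub>A\<^esub> y) = c \<odot>\<^bsub>A\<^esub> (x \<otimes>\<^bsub>A\<^esub> y)"
begin

lemma is_module: "module F A"
  by (rule A.module_axioms)

lemma prod_zero_left [simp]: "x \<in> carrier A \<Longrightarrow> \<zero>\<^bsub>A\<^esub> \<otimes>\<^bsub>A\<^esub> x = \<zero>\<^bsub>A\<^esub>"
  using prod_smult_left[of "\<zero>\<^bsub>F\<^esub>" "\<zero>\<^bsub>A\<^esub>" x] by simp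

lemma prod_zero_right [simp]: "x \<in> carrier A \<Longrightarrow> x \<otimes>\<^bsub>A\<^esub> \<zero>\<^bsub>A\<^esub> = \<zero>\<^bsub>A\<^esub>"
  using prod_smult_right[of "\<zero>\<^bsub>F\<^esub>" x "\<zero>\<^bsub>A\<^esub>"] by simp

lemma alg_ideal_Inter:
  assumes "\<And>I. I \<in> \<I> \<Longrightarrow> alg_ideal F A I" "\<I> \<noteq> {}"
  shows "alg_ideal F A (\<Inter>\<I>)"
  using assms submodule_Inter[of \<I>] unfolding alg_ideal_def by blast

lemma alg_ideal_carrier: "alg_ideal F A (carrier A)"
  by (simp add: alg_ideal_def carrier_is_submodule)

lemma gen_ideal_is_ideal: "S \<subseteq> carrier A \<Longrightarrow> alg_ideal F A (gen_ideal F A S)"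
  unfolding gen_ideal_def using alg_ideal_carrier by (intro alg_ideal_Inter) blast+

lemma gen_ideal_least: "\<lbrakk>alg_ideal F A I; S \<subseteq> I\<rbrakk> \<Longrightarrow> gen_ideal F A S \<subseteq> I"
  unfolding gen_ideal_def by blast

lemma gen_ideal_incl: "S \<subseteq> gen_ideal F A S"
  unfolding gen_ideal_def by blast

end

section \<open>Quotient algebras modulo an ideal\<close>

lemma alg_quot_sel:
  "carrier (alg_quot A I) = {I +>\<^bsub>A\<^esub> x | x. x \<in> carrier A}"
  "X \<otimes>\<^bsub>alg_quot A I\<^esub> Y = rcoset_mult A I X Y"
  "\<zero>\<^bsub>alg_quot A I\<^esub> = I"
  "X \<oplus>\<^bsub>alg_quot A I\<^esub> Y = X <+>\<^bsub>A\<^esub> Y"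
  "c \<odot>\<^bsub>alg_quot A I\<^esub> X = (\<Union>x\<in>X. I +>\<^bsub>A\<^esub> (c \<odot>\<^bsub>A\<^esub> x))"
  by (auto simp: alg_quot_def ring.defs module.defs FactRing_def A_RCOSETS_def')

locale algebra_ideal = nonassoc_algebra +
  fixes I
  assumes ideal: "alg_ideal F A I"
begin

lemma ideal_submodule: "submodule I F A"
  using ideal by (simp add: alg_ideal_def)

lemma ideal_subset: "x \<in> I \<Longrightarrow> x \<in> carrier A"
  using submoduleE(1)[OF ideal_submodule] by auto

lemma ideal_subgroup: "subgroup I (add_monoid A)"
  using ideal_submodule submodule.axioms(1) by blast

lemma ideal_abelian_subgroup: "abelian_subgroup I A"
  using abelian_subgroupI3[OF additive_subgroupI[OF ideal_subgroup]] M.abelian_group_axioms by blast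

lemma mem_coset:
  assumes "x \<in> carrier A"
  shows "y \<in> I +>\<^bsub>A\<^esub> x \<longleftrightarrow> y \<in> carrier A \<and> y \<ominus>\<^bsub>A\<^esub> x \<in> I"
proof
  assume "y \<in> I +>\<^bsub>A\<^esub> x"
  then obtain i where "i \<in> I" "y = i \<oplus>\<^bsub>A\<^esub> x"
    by (auto simp: a_r_coset_def')
  then show "y \<in> carrier A \<and> y \<ominus>\<^bsub>A\<^esub> x \<in> I"
    using assms ideal_subset by (simp add: a_minus_def M.a_assoc M.r_neg)
next
  assume y: "y \<in> carrier A \<and> y \<ominus>\<^bsub>A\<^esub> x \<in> I"
  then have "y = (y \<ominus>\<^bsub>A\<^esub> x) \<oplus>\<^bsub>A\<^esub> x"
    using assms by (simp add: a_minus_def M.a_assoc M.l_neg)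
  then show "y \<in> I +>\<^bsub>A\<^esub> x"
    using y by (auto simp: a_r_coset_def')
qed

lemma coset_self: "x \<in> carrier A \<Longrightarrow> x \<in> I +>\<^bsub>A\<^esub> x"
  by (simp add: mem_coset a_minus_def M.r_neg submodule_zero[OF ideal_submodule])

lemma coset_eq_iff:
  assumes "x \<in> carrier A" "y \<in> carrier A"
  shows "I +>\<^bsub>A\<^esub> x = I +>\<^bsub>A\<^esub> y \<longleftrightarrow> x \<ominus>\<^bsub>A\<^esub> y \<in> I"
proof
  assume "I +>\<^bsub>A\<^esub> x = I +>\<^bsub>A\<^esub> y"
  then show "x \<ominus>\<^bsub>A\<^esub> y \<in> I"
    using coset_self[of x] assms mem_coset by auto
next
  assume "x \<ominus>\<^bsub>A\<^esub> y \<in> I"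
  then have "x \<in> I +>\<^bsub>A\<^esub> y"
    using assms mem_coset by auto
  then show "I +>\<^bsub>A\<^esub> x = I +>\<^bsub>A\<^esub> y"
    using M.a_repr_independence[OF _ assms(2) ideal_subgroup] by simp
qed

lemma coset_eq_ideal_iff: "x \<in> carrier A \<Longrightarrow> I +>\<^bsub>A\<^esub> x = I \<longleftrightarrow> x \<in> I"
  using M.a_coset_join1 M.a_coset_join2 ideal_subgroup by blast

lemma coset_zero: "I +>\<^bsub>A\<^esub> \<zero>\<^bsub>A\<^esub> = I"
  by (simp add: coset_eq_ideal_iff submodule_zero[OF ideal_submodule])

lemma quot_carrierI [simp]: "x \<in> carrier A \<Longrightarrow> I +>\<^bsub>A\<^esub> x \<in> carrier (alg_quot A I)"
  by (auto simp: alg_quot_sel)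

lemma quot_carrierE:
  assumes "X \<in> carrier (alg_quot A I)"
  obtains x where "x \<in> carrier A" "X = I +>\<^bsub>A\<^esub> x"
  using assms by (auto simp: alg_quot_sel)

lemma quot_add:
  "\<lbrakk>x \<in> carrier A; y \<in> carrier A\<rbrakk> \<Longrightarrow>
    (I +>\<^bsub>A\<^esub> x) \<oplus>\<^bsub>alg_quot A I\<^esub> (I +>\<^bsub>A\<^esub> y) = I +>\<^bsub>A\<^esub> (x \<oplus>\<^bsub>A\<^esub> y)"
  by (simp add: alg_quot_sel abelian_subgroup.a_rcos_sum[OF ideal_abelian_subgroup])

text \<open>The scalar action on cosets is a union over representatives. All of them yield the same
  coset, so the union collapses; \<open>quot_mult\<close> rests on the same argument.\<close>

lemma quot_smult:
  assumes "c \<in> carrier F" "x \<in> carrier A"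
  shows "c \<odot>\<^bsub>alg_quot A I\<^esub> (I +>\<^bsub>A\<^esub> x) = I +>\<^bsub>A\<^esub> (c \<odot>\<^bsub>A\<^esub> x)"
proof -
  have "I +>\<^bsub>A\<^esub> (c \<odot>\<^bsub>A\<^esub> y) = I +>\<^bsub>A\<^esub> (c \<odot>\<^bsub>A\<^esub> x)" if "y \<in> I +>\<^bsub>A\<^esub> x" for y
  proof -
    have y: "y \<in> carrier A" "y \<ominus>\<^bsub>A\<^esub> x \<in> I"
      using that assms mem_coset by auto
    have "c \<odot>\<^bsub>A\<^esub> y \<ominus>\<^bsub>A\<^esub> c \<odot>\<^bsub>A\<^esub> x = c \<odot>\<^bsub>A\<^esub> (y \<ominus>\<^bsub>A\<^esub> x)"
      using y assms by (simp add: a_minus_def smult_r_distr smult_r_minus)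
    then show ?thesis
      using y assms submoduleE(4)[OF ideal_submodule] by (simp add: coset_eq_iff)
  qed
  then show ?thesis
    using coset_self[OF assms(2)] unfolding alg_quot_sel by blast
qed

lemma quot_mult:
  assumes x: "x \<in> carrier A" and y: "y \<in> carrier A"
  shows "(I +>\<^bsub>A\<^esub> x) \<otimes>\<^bsub>alg_quot A I\<^esub> (I +>\<^bsub>A\<^esub> y) = I +>\<^bsub>A\<^esub> (x \<otimes>\<^bsub>A\<^esub> y)"
proof -
  have "I +>\<^bsub>A\<^esub> (a \<otimes>\<^bsub>A\<^esub> b) = I +>\<^bsub>A\<^esub> (x \<otimes>\<^bsub>A\<^esub> y)" if "a \<in> I +>\<^bsub>A\<^esub> x" "b \<in> I +>\<^bsub>A\<^esub> y" for a b
  proof -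
    from that obtain i j where ij: "i \<in> I" "a = i \<oplus>\<^bsub>A\<^esub> x" "j \<in> I" "b = j \<oplus>\<^bsub>A\<^esub> y"
      by (auto simp: a_r_coset_def')
    have c: "i \<in> carrier A" "j \<in> carrier A" "a \<in> carrier A" "b \<in> carrier A"
      using ij x y ideal_subset by auto
    \<comment> \<open>Only one factor is expanded at a time: a b = i b + x b = i b + x j + x y,
      which leaves two summands that visibly lie in the ideal.\<close>
    have "a \<otimes>\<^bsub>A\<^esub> b = (i \<otimes>\<^bsub>A\<^esub> b \<oplus>\<^bsub>A\<^esub> x \<otimes>\<^bsub>A\<^esub> j) \<oplus>\<^bsub>A\<^esub> x \<otimes>\<^bsub>A\<^esub> y"
      using c x y by (simp add: ij(2,4) prod_add_left prod_add_right M.a_ac)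
    then have "a \<otimes>\<^bsub>A\<^esub> b \<ominus>\<^bsub>A\<^esub> x \<otimes>\<^bsub>A\<^esub> y = i \<otimes>\<^bsub>A\<^esub> b \<oplus>\<^bsub>A\<^esub> x \<otimes>\<^bsub>A\<^esub> j"
      using c x y by (simp add: a_minus_def M.a_assoc M.r_neg)
    moreover have "i \<otimes>\<^bsub>A\<^esub> b \<in> I" "x \<otimes>\<^bsub>A\<^esub> j \<in> I"
      using ideal ij c x by (auto simp: alg_ideal_def)
    ultimately show ?thesis
      using c x y submoduleE(5)[OF ideal_submodule] by (simp add: coset_eq_iff)
  qed
  then show ?thesis
    using coset_self[OF x] coset_self[OF y] unfolding alg_quot_sel rcoset_mult_def by blast
qed

lemma quot_zero: "\<zero>\<^bsub>alg_quot A I\<^esub> = I +>\<^bsub>A\<^esub> \<zero>\<^bsub>A\<^esub>"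
  by (simp add: coset_zero alg_quot_sel)

lemmas quot_ops = quot_add quot_smult quot_mult

lemma quot_algebra: "nonassoc_algebra F (alg_quot A I)"
proof -
  have "abelian_group (alg_quot A I)"
  proof (rule abelian_groupI)
    show "\<exists>Y\<in>carrier (alg_quot A I). Y \<oplus>\<^bsub>alg_quot A I\<^esub> X = \<zero>\<^bsub>alg_quot A I\<^esub>"
      if X: "X \<in> carrier (alg_quot A I)" for X
    proof -
      obtain x where x: "x \<in> carrier A" "X = I +>\<^bsub>A\<^esub> x"
        using X by (rule quot_carrierE)
      show ?thesis
        using x by (intro bexI[of _ "I +>\<^bsub>A\<^esub> (\<ominus>\<^bsub>A\<^esub> x)"])
          (simp_all add: quot_ops quot_zero M.l_neg del: M.a_coset_add_zero)
    qed
  qed (auto elim!: quot_carrierE simp: quot_ops M.a_ac quot_zero simp del: M.a_coset_add_zero)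
  then have "module F (alg_quot A I)"
    by (intro moduleI F.is_cring)
      (auto elim!: quot_carrierE simp: quot_ops smult_l_distr smult_r_distr smult_assoc1)
  then show ?thesis
    by (intro nonassoc_algebra.intro F.field_axioms nonassoc_algebra_axioms.intro)
      (auto elim!: quot_carrierE
        simp: quot_ops prod_add_left prod_add_right prod_smult_left prod_smult_right)
qed

text \<open>The value at a coset is \<open>h\<close> at a chosen representative; two representatives
  differ by an element of \<open>I\<close>, where \<open>h\<close> vanishes. Linearity is all that
  is transported, since the maps lifted later send products to zero.\<close>

lemma quot_lift:
  assumes M: "module F M" and h: "h \<in> lin_maps F A M" and ker: "\<And>x. x \<in> I \<Longrightarrow> h x = \<zero>\<^bsub>M\<^esub>"
  obtains g where "g \<in> lin_maps F (alg_quot A I) M" "\<forall>x\<in>carrier A. g (I +>\<^bsub>A\<^esub> x) = h x"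
proof -
  interpret M: module F M by fact
  define g where "g X = h (SOME x. x \<in> carrier A \<and> X = I +>\<^bsub>A\<^esub> x)" for X
  have g: "g (I +>\<^bsub>A\<^esub> x) = h x" if x: "x \<in> carrier A" for x
  proof -
    define y where "y = (SOME y. y \<in> carrier A \<and> I +>\<^bsub>A\<^esub> x = I +>\<^bsub>A\<^esub> y)"
    have y: "y \<in> carrier A \<and> I +>\<^bsub>A\<^esub> x = I +>\<^bsub>A\<^esub> y"
      unfolding y_def by (rule someI[of _ x]) (use x in simp)
    then have "x \<ominus>\<^bsub>A\<^esub> y \<in> I"
      using x coset_eq_iff by blast
    then have "h x \<ominus>\<^bsub>M\<^esub> h y = \<zero>\<^bsub>M\<^esub>"
      using x y ker lin_maps_diff[OF is_module M h] by metis
    then have "h x = h y"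
      using x y lin_mapsD(1)[OF h] by (simp add: M.diff_eq_zero_iff)
    then show ?thesis
      by (simp add: g_def y_def)
  qed
  have "g \<in> lin_maps F (alg_quot A I) M"
    unfolding lin_maps_def
    by (auto elim!: quot_carrierE simp: quot_ops g lin_mapsD[OF h])
  then show thesis
    using g that by blast
qed

text \<open>Any representatives of a spanning set will do: the image of \<open>U\<close> is then the
  whole quotient, and since \<open>U\<close> contains \<open>I\<close> it contains every coset that
  it meets. The conclusion speaks of submodules instead of linear combinations because the extension
  of B ends in a submodule containing \<open>I\<close> and \<open>E\<close>.\<close>

lemma finite_quot_span_lift:
  assumes "finite B" "B \<subseteq> carrier (alg_quot A I)"
    and span: "module_span F (alg_quot A I) B = carrier (alg_quot A I)"
  obtains E where "finite E" "E \<subseteq> carrier A"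
    "\<forall>U. submodule U F A \<and> I \<union> E \<subseteq> U \<longrightarrow> U = carrier A"
proof -
  interpret Q: nonassoc_algebra F "alg_quot A I" by (rule quot_algebra)
  have "\<forall>X\<in>B. \<exists>x. x \<in> carrier A \<and> X = I +>\<^bsub>A\<^esub> x"
    using assms(2) quot_carrierE by blast
  then obtain r where r: "\<And>X. X \<in> B \<Longrightarrow> r X \<in> carrier A \<and> X = I +>\<^bsub>A\<^esub> r X"
    by metis
  have "U = carrier A" if U: "submodule U F A" "I \<subseteq> U" "r ` B \<subseteq> U" for U
  proof
    show "U \<subseteq> carrier A"
      using submoduleE(1)[OF U(1)] .
    then have sub: "u \<in> carrier A" if "u \<in> U" for u
      using that by blast
    have "submodule {I +>\<^bsub>A\<^esub> u | u. u \<in> U} F (alg_quot A I)"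
    proof (rule Q.submoduleI')
      show "\<zero>\<^bsub>alg_quot A I\<^esub> \<in> {I +>\<^bsub>A\<^esub> u | u. u \<in> U}"
        using submodule_zero[OF U(1)] quot_zero by blast
      show "X \<oplus>\<^bsub>alg_quot A I\<^esub> Y \<in> {I +>\<^bsub>A\<^esub> u | u. u \<in> U}"
        if "X \<in> {I +>\<^bsub>A\<^esub> u | u. u \<in> U}" "Y \<in> {I +>\<^bsub>A\<^esub> u | u. u \<in> U}" for X Y
        using that submoduleE(5)[OF U(1)] by (auto simp: quot_ops sub)
      show "c \<odot>\<^bsub>alg_quot A I\<^esub> X \<in> {I +>\<^bsub>A\<^esub> u | u. u \<in> U}"
        if "c \<in> carrier F" "X \<in> {I +>\<^bsub>A\<^esub> u | u. u \<in> U}" for c X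
        using that submoduleE(4)[OF U(1)] by (auto simp: quot_ops sub)
    qed (auto simp: sub)
    moreover have "B \<subseteq> {I +>\<^bsub>A\<^esub> u | u. u \<in> U}"
      using r U(3) by blast
    ultimately have all: "carrier (alg_quot A I) \<subseteq> {I +>\<^bsub>A\<^esub> u | u. u \<in> U}"
      unfolding span[symmetric] by (rule Q.module_span_least)
    show "carrier A \<subseteq> U"
    proof
      fix x assume x: "x \<in> carrier A"
      obtain u where u: "u \<in> U" "I +>\<^bsub>A\<^esub> x = I +>\<^bsub>A\<^esub> u"
        using subsetD[OF all quot_carrierI[OF x]] by auto
      then have "x \<ominus>\<^bsub>A\<^esub> u \<in> U"
        using U(2) x sub coset_eq_iff by blast
      then have "(x \<ominus>\<^bsub>A\<^esub> u) \<oplus>\<^bsub>A\<^esub> u \<in> U"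
        using u submoduleE(5)[OF U(1)] by blast
      then show "x \<in> U"
        using x u sub by (simp add: a_minus_def M.a_assoc M.l_neg)
    qed
  qed
  then show thesis
    using that[of "r ` B"] assms(1) r by auto
qed

end


section \<open>The free nonassociative algebra\<close>

lemma free_alg_sel:
  "f \<in> carrier (free_alg F S) \<longleftrightarrow> (\<forall>w. f w \<in> carrier F) \<and> finite {w. f w \<noteq> \<zero>\<^bsub>F\<^esub>}
      \<and> (\<forall>w. f w \<noteq> \<zero>\<^bsub>F\<^esub> \<longrightarrow> set_magma w \<subseteq> S)"
  "f \<otimes>\<^bsub>free_alg F S\<^esub> g = (\<lambda>w. case w of Gen x \<Rightarrow> \<zero>\<^bsub>F\<^esub> | Prod u v \<Rightarrow> f u \<otimes>\<^bsub>F\<^esub> g v)"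
  "\<zero>\<^bsub>free_alg F S\<^esub> = (\<lambda>w. \<zero>\<^bsub>F\<^esub>)"
  "f \<oplus>\<^bsub>free_alg F S\<^esub> g = (\<lambda>w. f w \<oplus>\<^bsub>F\<^esub> g w)"
  "c \<odot>\<^bsub>free_alg F S\<^esub> f = (\<lambda>w. c \<otimes>\<^bsub>F\<^esub> f w)"
  by (simp_all add: free_alg_def)

lemma free_alg_carrierD:
  assumes "f \<in> carrier (free_alg F S)"
  shows "f w \<in> carrier F" "finite {w. f w \<noteq> \<zero>\<^bsub>F\<^esub>}" "f w \<noteq> \<zero>\<^bsub>F\<^esub> \<Longrightarrow> set_magma w \<subseteq> S"
  using assms by (auto simp: free_alg_sel)

context field
begin

text \<open>Coefficients of a sum may cancel, so a finite superset \<open>B\<close> of the support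
  is asked for instead of the support itself.\<close>

lemma free_alg_carrierI:
  assumes "\<And>w. f w \<in> carrier R" "finite B" "\<And>w. f w \<noteq> \<zero> \<Longrightarrow> w \<in> B \<and> set_magma w \<subseteq> S"
  shows "f \<in> carrier (free_alg R S)"
proof -
  have "{w. f w \<noteq> \<zero>} \<subseteq> B"
    using assms(3) by blast
  then show ?thesis
    using assms finite_subset[of _ B] by (auto simp: free_alg_sel)
qed

lemma free_alg_add_closed:
  assumes f: "f \<in> carrier (free_alg R S)" and g: "g \<in> carrier (free_alg R S)"
  shows "(\<lambda>w. f w \<oplus> g w) \<in> carrier (free_alg R S)"
proof (rule free_alg_carrierI)
  show "finite ({w. f w \<noteq> \<zero>} \<union> {w. g w \<noteq> \<zero>})"
    using f g by (simp add: free_alg_carrierD)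
  fix w
  show "f w \<oplus> g w \<in> carrier R"
    using f g by (simp add: free_alg_carrierD)
  assume "f w \<oplus> g w \<noteq> \<zero>"
  then have "f w \<noteq> \<zero> \<or> g w \<noteq> \<zero>"
    by auto
  then show "w \<in> {w. f w \<noteq> \<zero>} \<union> {w. g w \<noteq> \<zero>} \<and> set_magma w \<subseteq> S"
    using free_alg_carrierD(3)[OF f] free_alg_carrierD(3)[OF g] by auto
qed

lemma free_alg_smult_closed:
  assumes c: "c \<in> carrier R" and f: "f \<in> carrier (free_alg R S)"
  shows "(\<lambda>w. c \<otimes> f w) \<in> carrier (free_alg R S)"
proof (rule free_alg_carrierI)
  show "finite {w. f w \<noteq> \<zero>}"
    using f by (simp add: free_alg_carrierD)
  fix w
  show "c \<otimes> f w \<in> carrier R"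
    using c f by (simp add: free_alg_carrierD)
  assume "c \<otimes> f w \<noteq> \<zero>"
  then have "f w \<noteq> \<zero>"
    using c by auto
  then show "w \<in> {w. f w \<noteq> \<zero>} \<and> set_magma w \<subseteq> S"
    using free_alg_carrierD(3)[OF f] by auto
qed

lemma free_alg_mult_closed:
  assumes f: "f \<in> carrier (free_alg R S)" and g: "g \<in> carrier (free_alg R S)"
  shows "(\<lambda>w. case w of Gen x \<Rightarrow> \<zero> | Prod u v \<Rightarrow> f u \<otimes> g v) \<in> carrier (free_alg R S)"
proof (rule free_alg_carrierI)
  let ?B = "(\<lambda>(u, v). Prod u v) ` ({w. f w \<noteq> \<zero>} \<times> {w. g w \<noteq> \<zero>})"
  show "finite ?B"
    using f g by (intro finite_imageI finite_cartesian_product) (simp_all add: free_alg_carrierD)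
  fix w
  show "(case w of Gen x \<Rightarrow> \<zero> | Prod u v \<Rightarrow> f u \<otimes> g v) \<in> carrier R"
    using f g by (simp add: free_alg_carrierD split: magma.split)
  assume "(case w of Gen x \<Rightarrow> \<zero> | Prod u v \<Rightarrow> f u \<otimes> g v) \<noteq> \<zero>"
  then obtain u v where w: "w = Prod u v" "f u \<otimes> g v \<noteq> \<zero>"
    by (cases w) auto
  then have "f u \<noteq> \<zero>" "g v \<noteq> \<zero>"
    using free_alg_carrierD(1)[OF f] free_alg_carrierD(1)[OF g] by auto
  then show "w \<in> ?B \<and> set_magma w \<subseteq> S"
    using w free_alg_carrierD(3)[OF f] free_alg_carrierD(3)[OF g] by auto
qed

lemma free_alg_algebra: "nonassoc_algebra R (free_alg R S)"
proof -
  have "abelian_group (free_alg R S)"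
  proof (rule abelian_groupI)
    fix f assume f: "f \<in> carrier (free_alg R S)"
    show "\<exists>g\<in>carrier (free_alg R S). g \<oplus>\<^bsub>free_alg R S\<^esub> f = \<zero>\<^bsub>free_alg R S\<^esub>"
      using free_alg_smult_closed[OF _ f, of "\<ominus> \<one>"] free_alg_carrierD(1)[OF f]
      by (intro bexI[of _ "\<lambda>w. \<ominus> \<one> \<otimes> f w"]) (simp_all add: free_alg_sel(2-) l_minus l_neg)
    show "\<zero>\<^bsub>free_alg R S\<^esub> \<oplus>\<^bsub>free_alg R S\<^esub> f = f"
      using free_alg_carrierD(1)[OF f] by (simp add: free_alg_sel(2-))
  next
    show "\<zero>\<^bsub>free_alg R S\<^esub> \<in> carrier (free_alg R S)"
      by (simp add: free_alg_sel)
  next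
    fix f g h assume "f \<in> carrier (free_alg R S)" "g \<in> carrier (free_alg R S)" "h \<in> carrier (free_alg R S)"
    then show "f \<oplus>\<^bsub>free_alg R S\<^esub> g \<oplus>\<^bsub>free_alg R S\<^esub> h = f \<oplus>\<^bsub>free_alg R S\<^esub> (g \<oplus>\<^bsub>free_alg R S\<^esub> h)"
      by (simp add: free_alg_sel(2-) free_alg_carrierD(1) a_assoc)
  next
    fix f g assume "f \<in> carrier (free_alg R S)" "g \<in> carrier (free_alg R S)"
    then show "f \<oplus>\<^bsub>free_alg R S\<^esub> g \<in> carrier (free_alg R S)"
      "f \<oplus>\<^bsub>free_alg R S\<^esub> g = g \<oplus>\<^bsub>free_alg R S\<^esub> f"
      by (simp_all add: free_alg_sel(2-) free_alg_carrierD(1) free_alg_add_closed a_comm)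
  qed
  then have "module R (free_alg R S)"
    by (intro moduleI is_cring)
      (simp_all add: free_alg_sel(2-) free_alg_carrierD(1) free_alg_smult_closed l_distr r_distr m_assoc)
  then show ?thesis
    by (intro nonassoc_algebra.intro field_axioms nonassoc_algebra_axioms.intro)
      (simp_all add: free_alg_sel(2-) free_alg_carrierD(1) free_alg_mult_closed l_distr r_distr
        m_ac fun_eq_iff split: magma.split)
qed

lemma free_gen_closed: "x \<in> S \<Longrightarrow> free_gen R x \<in> carrier (free_alg R S)"
  by (rule free_alg_carrierI[of _ "{Gen x}"]) (auto simp: free_gen_def split: if_splits)

text \<open>The indicator function of a word is the product of the indicators of its two halves, so
  \<open>H\<close> contains the indicators of all words in \<open>S\<close>; every element is a
  finite linear combination of these.\<close>

lemma free_alg_induct: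
  fixes f :: "'x magma \<Rightarrow> 'a"
  assumes H: "submodule H R (free_alg R S)"
    and gen: "\<And>x. x \<in> S \<Longrightarrow> free_gen R x \<in> H"
    and mult: "\<And>f g. \<lbrakk>f \<in> H; g \<in> H\<rbrakk> \<Longrightarrow> f \<otimes>\<^bsub>free_alg R S\<^esub> g \<in> H"
    and f: "f \<in> carrier (free_alg R S)"
  shows "f \<in> H"
proof -
  interpret A: nonassoc_algebra R "free_alg R S"
    by (rule free_alg_algebra)
  define \<delta> where "\<delta> w = (\<lambda>v. if v = w then \<one> else \<zero>)" for w :: "'x magma"
  have \<delta>: "\<delta> w \<in> H" if "set_magma w \<subseteq> S" for w
    using that
  proof (induction w)
    case (Gen x)
    then show ?case
      using gen[of x] by (simp add: \<delta>_def free_gen_def)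
  next
    case (Prod u v)
    have "\<delta> (Prod u v) = \<delta> u \<otimes>\<^bsub>free_alg R S\<^esub> \<delta> v"
      by (auto simp: \<delta>_def free_alg_sel fun_eq_iff split: magma.split)
    then show ?case
      using mult Prod by simp
  qed
  \<comment> \<open>The set \<open>D\<close> need only contain the support. The induction can thus
    drop \<open>w\<close> from \<open>D\<close> even when the coefficient at \<open>w\<close> is
    zero.\<close>
  have "f \<in> carrier (free_alg R S) \<longrightarrow> {w. f w \<noteq> \<zero>} \<subseteq> D \<longrightarrow> f \<in> H" if "finite D" for D
    using that
  proof (induction D arbitrary: f)
    case empty
    show ?case
      using A.submodule_zero[OF H] by (auto simp: free_alg_sel(3) fun_eq_iff dest: ext)
  next
    case (insert w D)
    show ?case
    proof (intro impI)
      assume f: "f \<in> carrier (free_alg R S)" "{w. f w \<noteq> \<zero>} \<subseteq> insert w D"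
      show "f \<in> H"
      proof (cases "f w = \<zero>")
        case True
        then show ?thesis
          using insert.IH[of f] f by blast
      next
        case False
        define g where "g = f(w := \<zero>)"
        have fin: "finite {v. f v \<noteq> \<zero>}"
          using f(1) by (simp add: free_alg_carrierD)
        have "g \<in> carrier (free_alg R S)"
          using free_alg_carrierD[OF f(1)] by (intro free_alg_carrierI[OF _ fin]) (auto simp: g_def split: if_splits)
        moreover have "{v. g v \<noteq> \<zero>} \<subseteq> D"
          using f(2) by (auto simp: g_def)
        ultimately have "g \<in> H"
          using insert.IH by blast
        moreover have "f w \<odot>\<^bsub>free_alg R S\<^esub> \<delta> w \<in> H"
          using A.submoduleE(4)[OF H] \<delta> free_alg_carrierD[OF f(1)] False by blast
        moreover have "f = g \<oplus>\<^bsub>free_alg R S\<^esub> f w \<odot>\<^bsub>free_alg R S\<^esub> \<delta> w"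
          using free_alg_carrierD(1)[OF f(1)]
          by (auto simp: free_alg_sel g_def \<delta>_def fun_eq_iff)
        ultimately show ?thesis
          using A.submoduleE(5)[OF H] by metis
      qed
    qed
  qed
  then show ?thesis
    using f free_alg_carrierD(2)[OF f] by blast
qed

text \<open>The map reads only the coefficients at single generators. A product has coefficient zero
  there, so it goes to the empty sum. This is the homomorphism determined by \<beta> when
  \<open>M\<close> is given the zero bracket.\<close>

lemma free_alg_lift:
  assumes M: "module R M" and \<beta>: "\<And>x. x \<in> S \<Longrightarrow> \<beta> x \<in> carrier M"
  obtains h where "h \<in> lin_maps R (free_alg R S) M" "\<forall>x\<in>S. h (free_gen R x) = \<beta> x"
    "\<forall>f g. h (f \<otimes>\<^bsub>free_alg R S\<^esub> g) = \<zero>\<^bsub>M\<^esub>"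
proof -
  interpret M: module R M by fact
  define h where "h f = (\<Oplus>\<^bsub>M\<^esub>x\<in>{x. f (Gen x) \<noteq> \<zero>}. f (Gen x) \<odot>\<^bsub>M\<^esub> \<beta> x)" for f
  have fin: "finite {x. f (Gen x) \<noteq> \<zero>}" if "f \<in> carrier (free_alg R S)" for f
    using finite_vimageI[OF free_alg_carrierD(2)[OF that], of Gen] by (simp add: inj_def vimage_def)
  have supp: "{x. f (Gen x) \<noteq> \<zero>} \<subseteq> S" if "f \<in> carrier (free_alg R S)" for f
    using free_alg_carrierD(3)[OF that] by fastforce
  \<comment> \<open>The support varies with \<open>f\<close>. Over a common finite superset
    \<open>D\<close> the sums for two functions can be added termwise; \<open>D\<close> stays inside
    \<open>S\<close>, where \<beta> is known to take values in \<open>M\<close>.\<close>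
  have h: "h f = (\<Oplus>\<^bsub>M\<^esub>x\<in>D. f (Gen x) \<odot>\<^bsub>M\<^esub> \<beta> x)"
    if "f \<in> carrier (free_alg R S)" "finite D" "{x. f (Gen x) \<noteq> \<zero>} \<subseteq> D" "D \<subseteq> S" for f D
    unfolding h_def using that \<beta> free_alg_carrierD(1)[OF that(1)]
    by (intro M.add.finprod_mono_neutral_cong_left) (auto simp: Pi_def subset_iff)
  have "h \<in> lin_maps R (free_alg R S) M"
    unfolding lin_maps_def
  proof (intro CollectI conjI ballI Pi_I)
    fix f assume f: "f \<in> carrier (free_alg R S)"
    show "h f \<in> carrier M"
      unfolding h_def using supp[OF f] \<beta> free_alg_carrierD(1)[OF f]
      by (intro M.finsum_closed) auto
  next
    fix f g assume f: "f \<in> carrier (free_alg R S)" and g: "g \<in> carrier (free_alg R S)"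
    define D where "D = {x. f (Gen x) \<noteq> \<zero>} \<union> {x. g (Gen x) \<noteq> \<zero>}"
    have D: "finite D" "D \<subseteq> S"
      using fin f g supp by (auto simp: D_def)
    have fg: "f \<oplus>\<^bsub>free_alg R S\<^esub> g \<in> carrier (free_alg R S)"
      using free_alg_add_closed[OF f g] by (simp add: free_alg_sel)
    have "{x. (f \<oplus>\<^bsub>free_alg R S\<^esub> g) (Gen x) \<noteq> \<zero>} \<subseteq> D"
      by (auto simp: D_def free_alg_sel(4))
    then have "h (f \<oplus>\<^bsub>free_alg R S\<^esub> g) = (\<Oplus>\<^bsub>M\<^esub>x\<in>D. (f \<oplus>\<^bsub>free_alg R S\<^esub> g) (Gen x) \<odot>\<^bsub>M\<^esub> \<beta> x)"
      by (rule h[OF fg D(1) _ D(2)])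
    also have "\<dots> = (\<Oplus>\<^bsub>M\<^esub>x\<in>D. f (Gen x) \<odot>\<^bsub>M\<^esub> \<beta> x \<oplus>\<^bsub>M\<^esub> g (Gen x) \<odot>\<^bsub>M\<^esub> \<beta> x)"
      using D(2) \<beta> free_alg_carrierD(1)[OF f] free_alg_carrierD(1)[OF g]
      by (intro M.finsum_cong') (auto simp: free_alg_sel(4) M.smult_l_distr subset_iff)
    also have "\<dots> = (\<Oplus>\<^bsub>M\<^esub>x\<in>D. f (Gen x) \<odot>\<^bsub>M\<^esub> \<beta> x) \<oplus>\<^bsub>M\<^esub> (\<Oplus>\<^bsub>M\<^esub>x\<in>D. g (Gen x) \<odot>\<^bsub>M\<^esub> \<beta> x)"
      using D(2) \<beta> free_alg_carrierD(1)[OF f] free_alg_carrierD(1)[OF g]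
      by (intro M.finsum_addf) auto
    also have "\<dots> = h f \<oplus>\<^bsub>M\<^esub> h g"
      using h[OF f D(1) _ D(2)] h[OF g D(1) _ D(2)] by (simp add: D_def)
    finally show "h (f \<oplus>\<^bsub>free_alg R S\<^esub> g) = h f \<oplus>\<^bsub>M\<^esub> h g" .
  next
    fix c f assume c: "c \<in> carrier R" and f: "f \<in> carrier (free_alg R S)"
    let ?D = "{x. f (Gen x) \<noteq> \<zero>}"
    have cf: "c \<odot>\<^bsub>free_alg R S\<^esub> f \<in> carrier (free_alg R S)"
      using free_alg_smult_closed[OF c f] by (simp add: free_alg_sel)
    have "h (c \<odot>\<^bsub>free_alg R S\<^esub> f) = (\<Oplus>\<^bsub>M\<^esub>x\<in>?D. c \<odot>\<^bsub>M\<^esub> (f (Gen x) \<odot>\<^bsub>M\<^esub> \<beta> x))"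
      using c \<beta> supp[OF f] free_alg_carrierD(1)[OF f]
      by (subst h[OF cf fin[OF f] _ supp[OF f]])
        (auto simp: free_alg_sel(5) M.smult_assoc1 subset_iff intro!: M.finsum_cong')
    also have "\<dots> = c \<odot>\<^bsub>M\<^esub> h f"
      unfolding h_def using supp[OF f] \<beta> free_alg_carrierD(1)[OF f]
      by (intro M.finsum_smult_ldistr[symmetric] fin[OF f] c) auto
    finally show "h (c \<odot>\<^bsub>free_alg R S\<^esub> f) = c \<odot>\<^bsub>M\<^esub> h f" .
  qed
  moreover have "h (free_gen R x) = \<beta> x" if "x \<in> S" for x
    using that \<beta> h[OF free_gen_closed[OF that], of "{x}"] by (auto simp: free_gen_def)
  moreover have "h (f \<otimes>\<^bsub>free_alg R S\<^esub> g) = \<zero>\<^bsub>M\<^esub>" for f g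
    by (simp add: h_def free_alg_sel(2))
  ultimately show thesis
    by (intro that) blast+
qed

end


section \<open>Bilinear maps with prescribed diagonal\<close>

definition bilinear_maps ::
    "[('a, 'm) ring_scheme, ('a, 'b, 'n) module_scheme, ('a, 'c, 'k) module_scheme] \<Rightarrow> ('b \<Rightarrow> 'b \<Rightarrow> 'c) set"
  where "bilinear_maps F L M =
    {B. (\<forall>x\<in>carrier L. B x \<in> lin_maps F L M \<and> (\<lambda>y. B y x) \<in> lin_maps F L M)}"

lemma bilinear_mapsD:
  assumes "B \<in> bilinear_maps F L M"
  shows "\<lbrakk>x \<in> carrier L; y \<in> carrier L\<rbrakk> \<Longrightarrow> B x y \<in> carrier M"
    and "\<lbrakk>x \<in> carrier L; y \<in> carrier L; z \<in> carrier L\<rbrakk> \<Longrightarrow> B (x \<oplus>\<^bsub>L\<^esub> y) z = B x z \<oplus>\<^bsub>M\<^esub> B y z"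
    and "\<lbrakk>x \<in> carrier L; y \<in> carrier L; z \<in> carrier L\<rbrakk> \<Longrightarrow> B x (y \<oplus>\<^bsub>L\<^esub> z) = B x y \<oplus>\<^bsub>M\<^esub> B x z"
    and "\<lbrakk>c \<in> carrier F; x \<in> carrier L; y \<in> carrier L\<rbrakk> \<Longrightarrow> B (c \<odot>\<^bsub>L\<^esub> x) y = c \<odot>\<^bsub>M\<^esub> B x y"
    and "\<lbrakk>c \<in> carrier F; x \<in> carrier L; y \<in> carrier L\<rbrakk> \<Longrightarrow> B x (c \<odot>\<^bsub>L\<^esub> y) = c \<odot>\<^bsub>M\<^esub> B x y"
  using assms unfolding bilinear_maps_def lin_maps_def by auto

lemma bilinear_mapsI:
  assumes "\<And>x y. \<lbrakk>x \<in> carrier L; y \<in> carrier L\<rbrakk> \<Longrightarrow> B x y \<in> carrier M"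
    and "\<And>x y z. \<lbrakk>x \<in> carrier L; y \<in> carrier L; z \<in> carrier L\<rbrakk> \<Longrightarrow> B (x \<oplus>\<^bsub>L\<^esub> y) z = B x z \<oplus>\<^bsub>M\<^esub> B y z"
    and "\<And>x y z. \<lbrakk>x \<in> carrier L; y \<in> carrier L; z \<in> carrier L\<rbrakk> \<Longrightarrow> B x (y \<oplus>\<^bsub>L\<^esub> z) = B x y \<oplus>\<^bsub>M\<^esub> B x z"
    and "\<And>c x y. \<lbrakk>c \<in> carrier F; x \<in> carrier L; y \<in> carrier L\<rbrakk> \<Longrightarrow> B (c \<odot>\<^bsub>L\<^esub> x) y = c \<odot>\<^bsub>M\<^esub> B x y"
    and "\<And>c x y. \<lbrakk>c \<in> carrier F; x \<in> carrier L; y \<in> carrier L\<rbrakk> \<Longrightarrow> B x (c \<odot>\<^bsub>L\<^esub> y) = c \<odot>\<^bsub>M\<^esub> B x y"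
  shows "B \<in> bilinear_maps F L M"
  using assms unfolding bilinear_maps_def lin_maps_def by auto

text \<open>Later \<open>t\<close> is the tensor map, \<open>W\<close> is L^2 and \<open>N\<close>
  is the span of the squares. The last two assumptions place \<open>W\<close> in the radical of the
  quadratic map x \<mapsto> t x x; what is sought is a bilinear map into \<open>N\<close> with this
  diagonal that vanishes on \<open>W\<close> on both sides.\<close>

locale bilinear_diagonal = F: field F + L: module F L + M: module F M
  for F :: "('a, 'm) ring_scheme" (structure)
    and L :: "('a, 'b, 'n) module_scheme" (structure)
    and M :: "('a, 'c, 'k) module_scheme" (structure) +
  fixes t and W and N
  assumes t: "t \<in> bilinear_maps F L M"
    and W: "submodule W F L"
    and N: "submodule N F M"
    and diag_N: "x \<in> carrier L \<Longrightarrow> t x x \<in> N"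
    and diag_W: "w \<in> W \<Longrightarrow> t w w = \<zero>\<^bsub>M\<^esub>"
    and polar_W: "\<lbrakk>w \<in> W; x \<in> carrier L\<rbrakk> \<Longrightarrow> t w x \<oplus>\<^bsub>M\<^esub> t x w = \<zero>\<^bsub>M\<^esub>"
begin

text \<open>A partial solution on \<open>U\<close>. Replacing the carriers by \<open>U\<close> and
  \<open>N\<close> lets \<open>bilinear_maps\<close> express the smaller domain and the smaller
  range at once.\<close>

definition diag_ext :: "'b set \<Rightarrow> ('b \<Rightarrow> 'b \<Rightarrow> 'c) \<Rightarrow> bool"
  where "diag_ext U B \<longleftrightarrow> submodule U F L \<and> W \<subseteq> U
    \<and> B \<in> bilinear_maps F (L\<lparr>carrier := U\<rparr>) (M\<lparr>carrier := N\<rparr>)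
    \<and> (\<forall>x\<in>U. B x x = t x x) \<and> (\<forall>w\<in>W. \<forall>x\<in>U. B w x = \<zero>\<^bsub>M\<^esub> \<and> B x w = \<zero>\<^bsub>M\<^esub>)"

lemmas t_simps = bilinear_mapsD[OF t]

lemma N_carrier: "n \<in> N \<Longrightarrow> n \<in> carrier M"
  using M.submoduleE(1)[OF N] by blast

text \<open>The polar form is a combination of three diagonal values. This is why off-diagonal
  values of \<open>t\<close> may enter the extension only in the combination t v e + t e v.\<close>

lemma polar_N:
  assumes "x \<in> carrier L" "y \<in> carrier L"
  shows "t x y \<oplus>\<^bsub>M\<^esub> t y x \<in> N"
proof -
  have "t (x \<oplus>\<^bsub>L\<^esub> y) (x \<oplus>\<^bsub>L\<^esub> y) = (t x x \<oplus>\<^bsub>M\<^esub> t y y) \<oplus>\<^bsub>M\<^esub> (t x y \<oplus>\<^bsub>M\<^esub> t y x)"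
    using assms by (simp add: t_simps M.a_ac)
  then have "t x y \<oplus>\<^bsub>M\<^esub> t y x = t (x \<oplus>\<^bsub>L\<^esub> y) (x \<oplus>\<^bsub>L\<^esub> y) \<ominus>\<^bsub>M\<^esub> (t x x \<oplus>\<^bsub>M\<^esub> t y y)"
    using assms by (simp add: t_simps M.add_diff_cancel)
  then show ?thesis
    using assms M.submodule_diff[OF N] M.submoduleE(5)[OF N] diag_N by simp
qed

text \<open>Subtracting the two expressions gives (c - d) e = v - u in \<open>U\<close>; if c - d
  were nonzero, it could be inverted and \<open>e\<close> would lie in \<open>U\<close>.\<close>

lemma coordinate_unique:
  assumes U: "submodule U F L" and e: "e \<in> carrier L" "e \<notin> U"
    and "u \<in> U" "v \<in> U" "c \<in> carrier F" "d \<in> carrier F"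
    and eq: "u \<oplus>\<^bsub>L\<^esub> c \<odot>\<^bsub>L\<^esub> e = v \<oplus>\<^bsub>L\<^esub> d \<odot>\<^bsub>L\<^esub> e"
  shows "c = d \<and> u = v"
proof -
  have uv: "u \<in> carrier L" "v \<in> carrier L"
    using assms L.submoduleE(1)[OF U] by auto
  have ce: "c \<odot>\<^bsub>L\<^esub> e \<in> carrier L" "d \<odot>\<^bsub>L\<^esub> e \<in> carrier L"
    using assms by simp_all
  have "(c \<ominus>\<^bsub>F\<^esub> d) \<odot>\<^bsub>L\<^esub> e = c \<odot>\<^bsub>L\<^esub> e \<ominus>\<^bsub>L\<^esub> d \<odot>\<^bsub>L\<^esub> e"
    using assms(2,6,7) by (simp add: a_minus_def L.smult_l_distr L.smult_l_minus)
  also have "\<dots> = (u \<oplus>\<^bsub>L\<^esub> (c \<odot>\<^bsub>L\<^esub> e \<ominus>\<^bsub>L\<^esub> d \<odot>\<^bsub>L\<^esub> e)) \<ominus>\<^bsub>L\<^esub> u"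
    using ce uv by (simp add: L.add_diff_cancel)
  also have "u \<oplus>\<^bsub>L\<^esub> (c \<odot>\<^bsub>L\<^esub> e \<ominus>\<^bsub>L\<^esub> d \<odot>\<^bsub>L\<^esub> e) = (u \<oplus>\<^bsub>L\<^esub> c \<odot>\<^bsub>L\<^esub> e) \<ominus>\<^bsub>L\<^esub> d \<odot>\<^bsub>L\<^esub> e"
    using ce uv by (simp add: a_minus_def L.a_assoc)
  also have "\<dots> = v"
    unfolding eq using ce uv by (simp add: a_minus_def L.a_assoc L.r_neg)
  finally have cd: "(c \<ominus>\<^bsub>F\<^esub> d) \<odot>\<^bsub>L\<^esub> e = v \<ominus>\<^bsub>L\<^esub> u" .
  then have U': "(c \<ominus>\<^bsub>F\<^esub> d) \<odot>\<^bsub>L\<^esub> e \<in> U"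
    using L.submodule_diff[OF U] assms by simp
  have "c \<ominus>\<^bsub>F\<^esub> d = \<zero>\<^bsub>F\<^esub>"
  proof (rule ccontr)
    assume "c \<ominus>\<^bsub>F\<^esub> d \<noteq> \<zero>\<^bsub>F\<^esub>"
    then have unit: "c \<ominus>\<^bsub>F\<^esub> d \<in> Units F"
      using assms F.field_Units by simp
    then have "inv\<^bsub>F\<^esub> (c \<ominus>\<^bsub>F\<^esub> d) \<odot>\<^bsub>L\<^esub> ((c \<ominus>\<^bsub>F\<^esub> d) \<odot>\<^bsub>L\<^esub> e) \<in> U"
      using L.submoduleE(4)[OF U _ U'] by simp
    moreover have "inv\<^bsub>F\<^esub> (c \<ominus>\<^bsub>F\<^esub> d) \<odot>\<^bsub>L\<^esub> ((c \<ominus>\<^bsub>F\<^esub> d) \<odot>\<^bsub>L\<^esub> e) = e"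
      using unit e assms by (simp add: L.smult_assoc1[symmetric])
    ultimately show False
      using e by simp
  qed
  moreover have "c = (c \<ominus>\<^bsub>F\<^esub> d) \<oplus>\<^bsub>F\<^esub> d"
    using assms(6,7) by (simp add: a_minus_def F.a_assoc F.l_neg)
  ultimately have "c = d"
    using assms(7) by simp
  then show ?thesis
    using eq uv assms by simp
qed

text \<open>
  On \<open>U \<oplus> F e\<close> the extension is
  \<open>B' (u + c e) (v + d e) = B u v + c (t v e + t e v) + c d t e e\<close>; the polar form is split
  asymmetrically because a symmetric splitting would need to divide by 2.
\<close>

lemma diag_ext_insert:
  assumes ext: "diag_ext U B" and e: "e \<in> carrier L"
  shows "\<exists>U' B'. diag_ext U' B' \<and> insert e U \<subseteq> U'"
proof (cases "e \<in> U")
  case True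
  then show ?thesis
    using ext by blast
next
  case False
  have U: "submodule U F L" and WU: "W \<subseteq> U"
    and B: "B \<in> bilinear_maps F (L\<lparr>carrier := U\<rparr>) (M\<lparr>carrier := N\<rparr>)"
    and BU: "\<And>x. x \<in> U \<Longrightarrow> B x x = t x x"
    and BW: "\<And>w x. \<lbrakk>w \<in> W; x \<in> U\<rbrakk> \<Longrightarrow> B w x = \<zero>\<^bsub>M\<^esub> \<and> B x w = \<zero>\<^bsub>M\<^esub>"
    using ext by (auto simp: diag_ext_def)
  have UL: "u \<in> carrier L" if "u \<in> U" for u
    using L.submoduleE(1)[OF U] that by blast
  note Bs = bilinear_mapsD[OF B, simplified]
  have BM: "B u v \<in> carrier M" if "u \<in> U" "v \<in> U" for u v
    using Bs(1)[OF that] N_carrier by blast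
  define s where "s v = t v e \<oplus>\<^bsub>M\<^esub> t e v" for v
  have sM [simp]: "s v \<in> carrier M" if "v \<in> carrier L" for v
    using that e by (simp add: s_def t_simps)
  have s_add: "s (u \<oplus>\<^bsub>L\<^esub> v) = s u \<oplus>\<^bsub>M\<^esub> s v" if "u \<in> carrier L" "v \<in> carrier L" for u v
    using that e by (simp add: s_def t_simps M.a_ac)
  have s_smult: "s (c \<odot>\<^bsub>L\<^esub> v) = c \<odot>\<^bsub>M\<^esub> s v" if "c \<in> carrier F" "v \<in> carrier L" for c v
    using that e by (simp add: s_def t_simps M.smult_r_distr)
  define q where "q = t e e"
  have q [simp]: "q \<in> carrier M"
    using e by (simp add: q_def t_simps)
  define U' where "U' = {u \<oplus>\<^bsub>L\<^esub> c \<odot>\<^bsub>L\<^esub> e | u c. u \<in> U \<and> c \<in> carrier F}"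
  \<comment> \<open>The coordinates are chosen by description, and \<open>coordinate_unique\<close>
    makes the choice computable on explicit sums. Afterwards \<open>B'\<close> is used only through
    its formula on such sums.\<close>
  define p where "p x = (SOME p. fst p \<in> U \<and> snd p \<in> carrier F \<and> x = fst p \<oplus>\<^bsub>L\<^esub> snd p \<odot>\<^bsub>L\<^esub> e)" for x
  have p: "p (u \<oplus>\<^bsub>L\<^esub> c \<odot>\<^bsub>L\<^esub> e) = (u, c)" if uc: "u \<in> U" "c \<in> carrier F" for u c
    unfolding p_def
  proof (rule some_equality)
    fix p' assume "fst p' \<in> U \<and> snd p' \<in> carrier F
      \<and> u \<oplus>\<^bsub>L\<^esub> c \<odot>\<^bsub>L\<^esub> e = fst p' \<oplus>\<^bsub>L\<^esub> snd p' \<odot>\<^bsub>L\<^esub> e"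
    then show "p' = (u, c)"
      using coordinate_unique[OF U e False uc(1) _ uc(2), of "fst p'" "snd p'"]
      by (simp add: prod_eq_iff)
  qed (use uc in simp)
  define B' where "B' x y = B (fst (p x)) (fst (p y)) \<oplus>\<^bsub>M\<^esub>
    (snd (p x) \<odot>\<^bsub>M\<^esub> s (fst (p y)) \<oplus>\<^bsub>M\<^esub> (snd (p x) \<otimes>\<^bsub>F\<^esub> snd (p y)) \<odot>\<^bsub>M\<^esub> q)" for x y
  have B': "B' (u \<oplus>\<^bsub>L\<^esub> c \<odot>\<^bsub>L\<^esub> e) (v \<oplus>\<^bsub>L\<^esub> d \<odot>\<^bsub>L\<^esub> e) =
      B u v \<oplus>\<^bsub>M\<^esub> (c \<odot>\<^bsub>M\<^esub> s v \<oplus>\<^bsub>M\<^esub> (c \<otimes>\<^bsub>F\<^esub> d) \<odot>\<^bsub>M\<^esub> q)"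
    if "u \<in> U" "c \<in> carrier F" "v \<in> U" "d \<in> carrier F" for u c v d
    using that by (simp add: B'_def p)
  have U'_add: "(u \<oplus>\<^bsub>L\<^esub> c \<odot>\<^bsub>L\<^esub> e) \<oplus>\<^bsub>L\<^esub> (v \<oplus>\<^bsub>L\<^esub> d \<odot>\<^bsub>L\<^esub> e) = (u \<oplus>\<^bsub>L\<^esub> v) \<oplus>\<^bsub>L\<^esub> (c \<oplus>\<^bsub>F\<^esub> d) \<odot>\<^bsub>L\<^esub> e"
    if "u \<in> U" "c \<in> carrier F" "v \<in> U" "d \<in> carrier F" for u c v d
    using that e by (simp add: UL L.smult_l_distr L.a_ac)
  have U'_smult: "a \<odot>\<^bsub>L\<^esub> (u \<oplus>\<^bsub>L\<^esub> c \<odot>\<^bsub>L\<^esub> e) = a \<odot>\<^bsub>L\<^esub> u \<oplus>\<^bsub>L\<^esub> (a \<otimes>\<^bsub>F\<^esub> c) \<odot>\<^bsub>L\<^esub> e"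
    if "u \<in> U" "c \<in> carrier F" "a \<in> carrier F" for u c a
    using that e by (simp add: UL L.smult_r_distr L.smult_assoc1)
  have U_U': "u = u \<oplus>\<^bsub>L\<^esub> \<zero>\<^bsub>F\<^esub> \<odot>\<^bsub>L\<^esub> e" if "u \<in> U" for u
    using that e by (simp add: UL)
  note U_closed = L.submoduleE(4,5)[OF U] L.submodule_zero[OF U]
  have U'I: "u \<oplus>\<^bsub>L\<^esub> c \<odot>\<^bsub>L\<^esub> e \<in> U'" if "u \<in> U" "c \<in> carrier F" for u c
    using that by (auto simp: U'_def)
  have U'E: "\<exists>u c. u \<in> U \<and> c \<in> carrier F \<and> x = u \<oplus>\<^bsub>L\<^esub> c \<odot>\<^bsub>L\<^esub> e" if "x \<in> U'" for x
    using that by (auto simp: U'_def)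
  have UU': "U \<subseteq> U'"
    using U_U' U'I F.zero_closed by (metis subsetI)
  have sub: "submodule U' F L"
  proof (rule L.submoduleI')
    show "U' \<subseteq> carrier L"
      using e by (auto simp: U'_def UL)
    show "\<zero>\<^bsub>L\<^esub> \<in> U'"
      using UU' U_closed by blast
  next
    fix x y assume "x \<in> U'" "y \<in> U'"
    then obtain u c v d where "u \<in> U" "c \<in> carrier F" "x = u \<oplus>\<^bsub>L\<^esub> c \<odot>\<^bsub>L\<^esub> e"
        "v \<in> U" "d \<in> carrier F" "y = v \<oplus>\<^bsub>L\<^esub> d \<odot>\<^bsub>L\<^esub> e"
      using U'E by metis
    then show "x \<oplus>\<^bsub>L\<^esub> y \<in> U'"
      by (simp add: U'_add U'I U_closed)
  next
    fix a x assume "a \<in> carrier F" "x \<in> U'"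
    then show "a \<odot>\<^bsub>L\<^esub> x \<in> U'"
      using U'E[of x] by (auto simp: U'_smult intro!: U'I U_closed)
  qed
  have bil: "B' \<in> bilinear_maps F (L\<lparr>carrier := U'\<rparr>) (M\<lparr>carrier := N\<rparr>)"
  proof (rule bilinear_mapsI, goal_cases)
    case (1 x y)
    then obtain u c v d where *: "u \<in> U" "c \<in> carrier F" "x = u \<oplus>\<^bsub>L\<^esub> c \<odot>\<^bsub>L\<^esub> e"
        "v \<in> U" "d \<in> carrier F" "y = v \<oplus>\<^bsub>L\<^esub> d \<odot>\<^bsub>L\<^esub> e"
      using U'E[of x] U'E[of y] by auto
    \<comment> \<open>All three summands lie in \<open>N\<close>: the value of \<open>B\<close> by
      assumption, \<open>s v\<close> by \<open>polar_N\<close>, and \<open>q\<close> by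
      \<open>diag_N\<close>.\<close>
    then show ?case
      using Bs(1) M.submoduleE(4,5)[OF N] polar_N diag_N UL e by (simp add: B' s_def q_def)
  next
    case (2 x y z)
    then obtain u c v d w a where *: "u \<in> U" "c \<in> carrier F" "x = u \<oplus>\<^bsub>L\<^esub> c \<odot>\<^bsub>L\<^esub> e"
        "v \<in> U" "d \<in> carrier F" "y = v \<oplus>\<^bsub>L\<^esub> d \<odot>\<^bsub>L\<^esub> e"
        "w \<in> U" "a \<in> carrier F" "z = w \<oplus>\<^bsub>L\<^esub> a \<odot>\<^bsub>L\<^esub> e"
      using U'E[of x] U'E[of y] U'E[of z] by auto
    then show ?case
      by (simp add: U'_add B' Bs BM U_closed UL M.smult_l_distr F.l_distr M.a_ac)
  next
    case (3 x y z)
    then obtain u c v d w a where *: "u \<in> U" "c \<in> carrier F" "x = u \<oplus>\<^bsub>L\<^esub> c \<odot>\<^bsub>L\<^esub> e"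
        "v \<in> U" "d \<in> carrier F" "y = v \<oplus>\<^bsub>L\<^esub> d \<odot>\<^bsub>L\<^esub> e"
        "w \<in> U" "a \<in> carrier F" "z = w \<oplus>\<^bsub>L\<^esub> a \<odot>\<^bsub>L\<^esub> e"
      using U'E[of x] U'E[of y] U'E[of z] by auto
    then show ?case
      by (simp add: U'_add B' Bs BM U_closed UL s_add M.smult_l_distr M.smult_r_distr F.r_distr M.a_ac)
  next
    case (4 b x y)
    then obtain u c v d where *: "u \<in> U" "c \<in> carrier F" "x = u \<oplus>\<^bsub>L\<^esub> c \<odot>\<^bsub>L\<^esub> e"
        "v \<in> U" "d \<in> carrier F" "y = v \<oplus>\<^bsub>L\<^esub> d \<odot>\<^bsub>L\<^esub> e"
      using U'E[of x] U'E[of y] by auto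
    with 4 show ?case
      by (simp add: U'_smult B' Bs BM U_closed UL M.smult_r_distr M.smult_assoc1 F.m_assoc)
  next
    case (5 b x y)
    then obtain u c v d where *: "u \<in> U" "c \<in> carrier F" "x = u \<oplus>\<^bsub>L\<^esub> c \<odot>\<^bsub>L\<^esub> e"
        "v \<in> U" "d \<in> carrier F" "y = v \<oplus>\<^bsub>L\<^esub> d \<odot>\<^bsub>L\<^esub> e"
      using U'E[of x] U'E[of y] by auto
    with 5 show ?case
      by (simp add: U'_smult B' Bs BM U_closed UL s_smult M.smult_r_distr
          M.smult_assoc1[symmetric] F.m_ac)
  qed
  have diag: "B' x x = t x x" if "x \<in> U'" for x
  proof -
    obtain u c where u: "u \<in> U" "c \<in> carrier F" "x = u \<oplus>\<^bsub>L\<^esub> c \<odot>\<^bsub>L\<^esub> e"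
      using U'E[OF \<open>x \<in> U'\<close>] by blast
    \<comment> \<open>Expanding gives t x x = t u u + c (t u e + t e u) + c^2 t e e. The middle term
      is c times \<open>s u\<close>, so a one-sided cross term already produces the right
      diagonal.\<close>
    then show ?thesis
      using UL e by (simp add: B' BU t_simps s_def q_def M.smult_r_distr M.smult_assoc1 M.a_ac)
  qed
  have BW': "B' w x = \<zero>\<^bsub>M\<^esub> \<and> B' x w = \<zero>\<^bsub>M\<^esub>" if w: "w \<in> W" and x: "x \<in> U'" for w x
  proof -
    obtain u c where u: "u \<in> U" "c \<in> carrier F" "x = u \<oplus>\<^bsub>L\<^esub> c \<odot>\<^bsub>L\<^esub> e"
      using U'E[OF x] by blast
    have wU: "w \<in> U"
      using w WU by blast
    \<comment> \<open>As \<open>w\<close> has coordinate 0 along \<open>e\<close>, only B' x w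
      retains an extra term, namely c times \<open>s w\<close>; it vanishes because \<open>W\<close>
      lies in the radical of the polar form.\<close>
    have "s w = \<zero>\<^bsub>M\<^esub>"
      using polar_W[OF w e] by (simp add: s_def)
    then show ?thesis
      using B'[OF wU F.zero_closed u(1,2)] B'[OF u(1,2) wU F.zero_closed] BW[OF w u(1)] u wU UL
      by (simp add: U_U'[OF wU, symmetric])
  qed
  have "e \<in> U'"
    using U'I[OF U_closed(3) F.one_closed] e by simp
  then have "diag_ext U' B' \<and> insert e U \<subseteq> U'"
    unfolding diag_ext_def using sub WU UU' bil diag BW' by auto
  then show ?thesis
    by blast
qed

lemma bilinear_with_diagonal:
  assumes E: "finite E" "E \<subseteq> carrier L"
    and gen: "\<forall>U. submodule U F L \<and> W \<union> E \<subseteq> U \<longrightarrow> U = carrier L"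
  obtains B where "B \<in> bilinear_maps F L (M\<lparr>carrier := N\<rparr>)"
    "\<forall>x\<in>carrier L. B x x = t x x"
    "\<forall>w\<in>W. \<forall>x\<in>carrier L. B w x = \<zero>\<^bsub>M\<^esub> \<and> B x w = \<zero>\<^bsub>M\<^esub>"
proof -
  have "\<exists>U B. diag_ext U B \<and> E \<subseteq> U"
    using E
  proof (induction rule: finite_induct)
    case empty
    \<comment> \<open>The induction starts from the zero form on \<open>W\<close>, whose diagonal is
      correct by \<open>diag_W\<close>.\<close>
    have "(\<lambda>x y. \<zero>\<^bsub>M\<^esub>) \<in> bilinear_maps F (L\<lparr>carrier := W\<rparr>) (M\<lparr>carrier := N\<rparr>)"
      by (rule bilinear_mapsI) (simp_all add: M.submodule_zero[OF N])
    then have "diag_ext W (\<lambda>x y. \<zero>\<^bsub>M\<^esub>)"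
      by (simp add: diag_ext_def W diag_W)
    then show ?case
      by blast
  next
    case (insert e E)
    then obtain U B where "diag_ext U B" "E \<subseteq> U" "e \<in> carrier L"
      by auto
    then show ?case
      using diag_ext_insert[of U B e] by (metis insert_subset subset_trans)
  qed
  then obtain U B where B: "diag_ext U B" "E \<subseteq> U"
    by blast
  then have "U = carrier L"
    using gen by (simp add: diag_ext_def)
  \<comment> \<open>Turns bilinearity over the restricted structure into bilinearity over
    \<open>L\<close>.\<close>
  then have "L\<lparr>carrier := U\<rparr> = L"
    by simp
  then show thesis
    using that[of B] B \<open>U = carrier L\<close> unfolding diag_ext_def by auto
qed

end


section \<open>Crossed pairings and the splitting\<close>

sublocale lie_algebra \<subseteq> nonassoc_algebra F L
  by unfold_locales
    (simp_all add: bracket_add_left bracket_add_right bracket_smult_left bracket_smult_right)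

context lie_algebra
begin

lemma bracket_anticomm:
  assumes "x \<in> carrier L" "y \<in> carrier L"
  shows "\<lblot>x, y\<rblot>\<^bsub>L\<^esub> = \<ominus>\<^bsub>L\<^esub> \<lblot>y, x\<rblot>\<^bsub>L\<^esub>"
proof -
  have "\<zero>\<^bsub>L\<^esub> = \<lblot>x, x \<oplus>\<^bsub>L\<^esub> y\<rblot>\<^bsub>L\<^esub> \<oplus>\<^bsub>L\<^esub> \<lblot>y, x \<oplus>\<^bsub>L\<^esub> y\<rblot>\<^bsub>L\<^esub>"
    using assms bracket_self[of "x \<oplus>\<^bsub>L\<^esub> y"] bracket_add_left[of x y "x \<oplus>\<^bsub>L\<^esub> y"] by simp
  also have "\<dots> = \<lblot>x, y\<rblot>\<^bsub>L\<^esub> \<oplus>\<^bsub>L\<^esub> \<lblot>y, x\<rblot>\<^bsub>L\<^esub>"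
    using assms by (simp add: bracket_add_right bracket_self)
  finally show ?thesis
    using assms M.minus_equality[of "\<lblot>x, y\<rblot>\<^bsub>L\<^esub>" "\<lblot>y, x\<rblot>\<^bsub>L\<^esub>"] by simp
qed

lemma derived_subalgebra_submodule: "submodule (derived_subalgebra F L) F L"
  unfolding derived_subalgebra_def by (rule module_span_submodule) auto

lemma bracket_in_derived:
  "\<lbrakk>x \<in> carrier L; y \<in> carrier L\<rbrakk> \<Longrightarrow> \<lblot>x, y\<rblot>\<^bsub>L\<^esub> \<in> derived_subalgebra F L"
  unfolding derived_subalgebra_def by (rule subsetD[OF module_span_incl]) blast

lemma derived_subalgebra_ideal: "alg_ideal F L (derived_subalgebra F L)"
  using derived_subalgebra_submodule bracket_in_derived submoduleE(1)[OF derived_subalgebra_submodule]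
  unfolding alg_ideal_def by blast

end

lemma lie_dirsum_sel:
  "carrier (lie_dirsum M N) = carrier M \<times> carrier N"
  "X \<otimes>\<^bsub>lie_dirsum M N\<^esub> Y = (fst X \<otimes>\<^bsub>M\<^esub> fst Y, snd X \<otimes>\<^bsub>N\<^esub> snd Y)"
  "X \<oplus>\<^bsub>lie_dirsum M N\<^esub> Y = (fst X \<oplus>\<^bsub>M\<^esub> fst Y, snd X \<oplus>\<^bsub>N\<^esub> snd Y)"
  "c \<odot>\<^bsub>lie_dirsum M N\<^esub> X = (c \<odot>\<^bsub>M\<^esub> fst X, c \<odot>\<^bsub>N\<^esub> snd X)"
  by (simp_all add: lie_dirsum_def RDirProd_def DirProd_def ring.defs module.defs monoid.defs
      case_prod_unfold)

text \<open>
  The last assumption is the part of the universal property of the tensor square concerning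
  abelian targets; the crossed relations and the product vanish there as soon as the bilinear map
  kills \<open>L\<^sup>2\<close> in both arguments.
\<close>

locale tensor_pairing = L: lie_algebra F L + T: lie_algebra F T
  for F :: "('a, 'm) ring_scheme" (structure)
    and L :: "('a, 'b, 'n) module_scheme" (structure)
    and T :: "('a, 'c, 'k) module_scheme" (structure) +
  fixes t :: "'b \<Rightarrow> 'b \<Rightarrow> 'c"
  assumes t_bilinear: "t \<in> bilinear_maps F L T"
    and t_bracket_left:
      "\<lbrakk>l \<in> carrier L; l' \<in> carrier L; k \<in> carrier L\<rbrakk> \<Longrightarrow>
        t \<lblot>l, l'\<rblot>\<^bsub>L\<^esub> k = t l \<lblot>l', k\<rblot>\<^bsub>L\<^esub> \<ominus>\<^bsub>T\<^esub> t l' \<lblot>l, k\<rblot>\<^bsub>L\<^esub>"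
    and t_bracket_right:
      "\<lbrakk>l \<in> carrier L; k \<in> carrier L; k' \<in> carrier L\<rbrakk> \<Longrightarrow>
        t l \<lblot>k, k'\<rblot>\<^bsub>L\<^esub> = t \<lblot>k', l\<rblot>\<^bsub>L\<^esub> k \<ominus>\<^bsub>T\<^esub> t \<lblot>k, l\<rblot>\<^bsub>L\<^esub> k'"
    and bracket_t:
      "\<lbrakk>l \<in> carrier L; k \<in> carrier L; l' \<in> carrier L; k' \<in> carrier L\<rbrakk> \<Longrightarrow>
        \<lblot>t l k, t l' k'\<rblot>\<^bsub>T\<^esub> = \<ominus>\<^bsub>T\<^esub> t \<lblot>k, l\<rblot>\<^bsub>L\<^esub> \<lblot>l', k'\<rblot>\<^bsub>L\<^esub>"
    and t_generates:
      "\<lbrakk>submodule H F T; \<And>l k. \<lbrakk>l \<in> carrier L; k \<in> carrier L\<rbrakk> \<Longrightarrow> t l k \<in> H;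
        \<And>x y. \<lbrakk>x \<in> H; y \<in> H\<rbrakk> \<Longrightarrow> \<lblot>x, y\<rblot>\<^bsub>T\<^esub> \<in> H; z \<in> carrier T\<rbrakk> \<Longrightarrow> z \<in> H"
    and t_lift:
      "\<lbrakk>B \<in> bilinear_maps F L T;
        \<And>w x. \<lbrakk>w \<in> derived_subalgebra F L; x \<in> carrier L\<rbrakk> \<Longrightarrow> B w x = \<zero>\<^bsub>T\<^esub>;
        \<And>w x. \<lbrakk>w \<in> derived_subalgebra F L; x \<in> carrier L\<rbrakk> \<Longrightarrow> B x w = \<zero>\<^bsub>T\<^esub>\<rbrakk> \<Longrightarrow>
        \<exists>h\<in>lin_maps F T T. (\<forall>l\<in>carrier L. \<forall>k\<in>carrier L. h (t l k) = B l k)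
          \<and> (\<forall>x\<in>carrier T. \<forall>y\<in>carrier T. h \<lblot>x, y\<rblot>\<^bsub>T\<^esub> = \<zero>\<^bsub>T\<^esub>)"
begin

lemmas t_simps = bilinear_mapsD[OF t_bilinear]

lemma t_lin:
  "l \<in> carrier L \<Longrightarrow> t l \<in> lin_maps F L T" "l \<in> carrier L \<Longrightarrow> (\<lambda>k. t k l) \<in> lin_maps F L T"
  using t_bilinear by (auto simp: bilinear_maps_def)

lemmas t_zero = lin_maps_zero[OF L.is_module T.is_module t_lin(1)]
  lin_maps_zero[OF L.is_module T.is_module t_lin(2)]

lemmas t_minus = lin_maps_minus[OF L.is_module T.is_module t_lin(1)]
  lin_maps_minus[OF L.is_module T.is_module t_lin(2)]

section \<open>The polar form of the diagonal and its radical\<close>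

definition polar :: "'b \<Rightarrow> 'b \<Rightarrow> 'c"
  where "polar l k = t l k \<oplus>\<^bsub>T\<^esub> t k l"

lemma polar_closed [simp]: "\<lbrakk>l \<in> carrier L; k \<in> carrier L\<rbrakk> \<Longrightarrow> polar l k \<in> carrier T"
  by (simp add: polar_def t_simps)

lemma polar_add_left:
  "\<lbrakk>x \<in> carrier L; y \<in> carrier L; z \<in> carrier L\<rbrakk> \<Longrightarrow>
    polar (x \<oplus>\<^bsub>L\<^esub> y) z = polar x z \<oplus>\<^bsub>T\<^esub> polar y z"
  by (simp add: polar_def t_simps T.M.a_ac)

lemma polar_add_right:
  "\<lbrakk>x \<in> carrier L; y \<in> carrier L; z \<in> carrier L\<rbrakk> \<Longrightarrow>
    polar x (y \<oplus>\<^bsub>L\<^esub> z) = polar x y \<oplus>\<^bsub>T\<^esub> polar x z"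
  by (simp add: polar_def t_simps T.M.a_ac)

lemma polar_smult_left:
  "\<lbrakk>c \<in> carrier F; x \<in> carrier L; y \<in> carrier L\<rbrakk> \<Longrightarrow> polar (c \<odot>\<^bsub>L\<^esub> x) y = c \<odot>\<^bsub>T\<^esub> polar x y"
  by (simp add: polar_def t_simps T.smult_r_distr)

lemma polar_minus_left:
  "\<lbrakk>x \<in> carrier L; y \<in> carrier L\<rbrakk> \<Longrightarrow> polar (\<ominus>\<^bsub>L\<^esub> x) y = \<ominus>\<^bsub>T\<^esub> polar x y"
  by (simp add: polar_def t_minus t_simps T.M.minus_add)

text \<open>For k = a the first crossed relation loses the term containing [a, a]; anticommutativity
  turns what remains into the negative of t a [a, b].\<close>

lemma polar_bracket_self:
  assumes "a \<in> carrier L" "b \<in> carrier L"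
  shows "polar \<lblot>a, b\<rblot>\<^bsub>L\<^esub> a = \<zero>\<^bsub>T\<^esub>"
proof -
  have "t \<lblot>a, b\<rblot>\<^bsub>L\<^esub> a = t a \<lblot>b, a\<rblot>\<^bsub>L\<^esub>"
    using assms t_bracket_left[of a b a] by (simp add: L.bracket_self t_zero t_simps a_minus_def)
  also have "\<dots> = \<ominus>\<^bsub>T\<^esub> t a \<lblot>a, b\<rblot>\<^bsub>L\<^esub>"
    using assms L.bracket_anticomm[of b a] by (simp add: t_minus)
  finally show ?thesis
    using assms by (simp add: polar_def t_simps T.M.l_neg)
qed

text \<open>Polarization of \<open>polar_bracket_self\<close>: replace a by a + c and keep the mixed
  terms.\<close>

lemma polar_bracket_swap:
  assumes "a \<in> carrier L" "b \<in> carrier L" "c \<in> carrier L"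
  shows "polar \<lblot>a, b\<rblot>\<^bsub>L\<^esub> c = \<ominus>\<^bsub>T\<^esub> polar \<lblot>c, b\<rblot>\<^bsub>L\<^esub> a"
proof -
  have "\<zero>\<^bsub>T\<^esub> = polar \<lblot>a \<oplus>\<^bsub>L\<^esub> c, b\<rblot>\<^bsub>L\<^esub> (a \<oplus>\<^bsub>L\<^esub> c)"
    using assms by (simp add: polar_bracket_self)
  also have "\<dots> = polar \<lblot>a, b\<rblot>\<^bsub>L\<^esub> c \<oplus>\<^bsub>T\<^esub> polar \<lblot>c, b\<rblot>\<^bsub>L\<^esub> a"
    using assms
    by (simp add: L.bracket_add_left polar_add_left polar_add_right polar_bracket_self T.M.a_comm)
  finally show ?thesis
    using assms T.M.minus_equality[of "polar \<lblot>a, b\<rblot>\<^bsub>L\<^esub> c" "polar \<lblot>c, b\<rblot>\<^bsub>L\<^esub> a"] by simp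
qed

lemma polar_bracket_cycle:
  assumes "a \<in> carrier L" "b \<in> carrier L" "c \<in> carrier L"
  shows "polar \<lblot>a, b\<rblot>\<^bsub>L\<^esub> c = polar \<lblot>b, c\<rblot>\<^bsub>L\<^esub> a"
  using assms polar_bracket_swap[OF assms] L.bracket_anticomm[of c b]
  by (simp add: polar_minus_left)

text \<open>
  Being invariant under cyclic shifts of \<open>a, b, c\<close>, the value \<open>p\<close> of the polar form at
  \<open>([a, b], c)\<close> satisfies \<open>p = p + p\<close> by the crossed relations, in every characteristic.
\<close>

lemma polar_bracket:
  assumes abc: "a \<in> carrier L" "b \<in> carrier L" "c \<in> carrier L"
  shows "polar \<lblot>a, b\<rblot>\<^bsub>L\<^esub> c = \<zero>\<^bsub>T\<^esub>"
proof -
  \<comment> \<open>The sum of the relations t [a, b] c = t a [b, c] - t b [a, c] and t c [a, b] = t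
    [b, c] a - t [a, c] b, regrouped into polar forms.\<close>
  have "polar \<lblot>a, b\<rblot>\<^bsub>L\<^esub> c = polar \<lblot>b, c\<rblot>\<^bsub>L\<^esub> a \<ominus>\<^bsub>T\<^esub> polar \<lblot>a, c\<rblot>\<^bsub>L\<^esub> b"
    using abc t_bracket_left[of a b c] t_bracket_right[of c a b]
    by (simp add: polar_def t_simps a_minus_def T.M.minus_add T.M.a_ac)
  also have "\<dots> = polar \<lblot>b, c\<rblot>\<^bsub>L\<^esub> a \<oplus>\<^bsub>T\<^esub> polar \<lblot>c, a\<rblot>\<^bsub>L\<^esub> b"
    using abc L.bracket_anticomm[of a c] by (simp add: polar_minus_left a_minus_def)
  also have "\<dots> = polar \<lblot>a, b\<rblot>\<^bsub>L\<^esub> c \<oplus>\<^bsub>T\<^esub> polar \<lblot>a, b\<rblot>\<^bsub>L\<^esub> c"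
    using abc by (simp add: polar_bracket_cycle[of a b c] polar_bracket_cycle[of b c a])
  finally show ?thesis
    using abc T.M.add.r_cancel_one' by (metis L.bracket_closed polar_closed)
qed

text \<open>The product relation with two equal factors identifies this element with the bracket of
  \<open>t l k\<close> with itself.\<close>

lemma diagonal_bracket:
  assumes "k \<in> carrier L" "l \<in> carrier L"
  shows "t \<lblot>k, l\<rblot>\<^bsub>L\<^esub> \<lblot>k, l\<rblot>\<^bsub>L\<^esub> = \<zero>\<^bsub>T\<^esub>"
proof -
  have "\<lblot>t l k, t l k\<rblot>\<^bsub>T\<^esub> = \<ominus>\<^bsub>T\<^esub> t \<lblot>k, l\<rblot>\<^bsub>L\<^esub> (\<ominus>\<^bsub>L\<^esub> \<lblot>k, l\<rblot>\<^bsub>L\<^esub>)"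
    using assms bracket_t[of l k l k] L.bracket_anticomm[of l k] by simp
  then show ?thesis
    using assms by (simp add: t_minus t_simps T.bracket_self)
qed

text \<open>Both properties have to be carried together: t (w + v) (w + v) contains the cross term
  \<open>polar w v\<close>, so vanishing of the diagonal alone need not survive addition. Together
  they define a submodule, and it contains all brackets.\<close>

lemma derived_radical:
  assumes "w \<in> derived_subalgebra F L"
  shows "t w w = \<zero>\<^bsub>T\<^esub>" and "x \<in> carrier L \<Longrightarrow> polar w x = \<zero>\<^bsub>T\<^esub>"
proof -
  let ?R = "{w \<in> carrier L. t w w = \<zero>\<^bsub>T\<^esub> \<and> (\<forall>x\<in>carrier L. polar w x = \<zero>\<^bsub>T\<^esub>)}"
  have "submodule ?R F L"
  proof (rule L.submoduleI')
    show "\<zero>\<^bsub>L\<^esub> \<in> ?R"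
      by (simp add: t_zero polar_def)
  next
    fix w v assume w: "w \<in> ?R" and v: "v \<in> ?R"
    then have "t (w \<oplus>\<^bsub>L\<^esub> v) (w \<oplus>\<^bsub>L\<^esub> v) = polar w v"
      by (simp add: t_simps polar_def)
    then show "w \<oplus>\<^bsub>L\<^esub> v \<in> ?R"
      using w v by (simp add: polar_add_left)
  next
    fix c w assume "c \<in> carrier F" "w \<in> ?R"
    then show "c \<odot>\<^bsub>L\<^esub> w \<in> ?R"
      by (simp add: t_simps polar_smult_left)
  qed auto
  then have "derived_subalgebra F L \<subseteq> ?R"
    unfolding derived_subalgebra_def
    by (rule L.module_span_least) (auto simp: diagonal_bracket polar_bracket)
  then show "t w w = \<zero>\<^bsub>T\<^esub>" and "x \<in> carrier L \<Longrightarrow> polar w x = \<zero>\<^bsub>T\<^esub>"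
    using assms by auto
qed

section \<open>Centrality of the span of the squares\<close>

definition square :: "'c set"
  where "square = module_span F T {t l l | l. l \<in> carrier L}"

lemma square_submodule: "submodule square F T"
  unfolding square_def by (rule T.module_span_submodule) (auto simp: t_simps)

lemma square_carrier: "x \<in> square \<Longrightarrow> x \<in> carrier T"
  using T.submoduleE(1)[OF square_submodule] by blast

lemma diagonal_in_square: "l \<in> carrier L \<Longrightarrow> t l l \<in> square"
  unfolding square_def by (rule subsetD[OF T.module_span_incl]) blast

text \<open>On a generator \<open>t a b\<close> the product relation yields a tensor whose second
  factor is [l, l] = 0. By the Jacobi identity the centralizer of an element is closed under
  brackets, so it is all of \<open>T\<close>.\<close>

lemma bracket_diagonal:
  assumes "l \<in> carrier L" "y \<in> carrier T"
  shows "\<lblot>y, t l l\<rblot>\<^bsub>T\<^esub> = \<zero>\<^bsub>T\<^esub>"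
proof -
  let ?z = "t l l"
  let ?C = "{y \<in> carrier T. \<lblot>y, ?z\<rblot>\<^bsub>T\<^esub> = \<zero>\<^bsub>T\<^esub>}"
  have z: "?z \<in> carrier T"
    using assms by (simp add: t_simps)
  have "y \<in> ?C"
  proof (rule t_generates[OF _ _ _ assms(2)])
    show "submodule ?C F T"
      by (rule T.submoduleI') (auto simp: z T.bracket_add_left T.bracket_smult_left)
    show "t a b \<in> ?C" if "a \<in> carrier L" "b \<in> carrier L" for a b
      using that assms by (simp add: bracket_t L.bracket_self t_zero t_simps)
    show "\<lblot>u, v\<rblot>\<^bsub>T\<^esub> \<in> ?C" if uv: "u \<in> ?C" "v \<in> ?C" for u v
    proof -
      have zu: "\<lblot>?z, u\<rblot>\<^bsub>T\<^esub> = \<zero>\<^bsub>T\<^esub>"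
        using uv z T.bracket_anticomm[of ?z u] by simp
      \<comment> \<open>In the Jacobi identity for \<open>?z\<close>, \<open>u\<close>,
        \<open>v\<close> the other two terms contain [v, ?z] and [?z, u], which are both
        zero.\<close>
      have "\<lblot>?z, \<lblot>u, v\<rblot>\<^bsub>T\<^esub>\<rblot>\<^bsub>T\<^esub> = \<zero>\<^bsub>T\<^esub>"
        using T.jacobi[of ?z u v] uv z zu by simp
      then show ?thesis
        using uv z T.bracket_anticomm[of "\<lblot>u, v\<rblot>\<^bsub>T\<^esub>" ?z] by simp
    qed
  qed
  then show ?thesis
    by simp
qed

lemma bracket_square:
  assumes "y \<in> carrier T" "x \<in> square"
  shows "\<lblot>y, x\<rblot>\<^bsub>T\<^esub> = \<zero>\<^bsub>T\<^esub>" "\<lblot>x, y\<rblot>\<^bsub>T\<^esub> = \<zero>\<^bsub>T\<^esub>"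
proof -
  have "submodule {x \<in> carrier T. \<lblot>y, x\<rblot>\<^bsub>T\<^esub> = \<zero>\<^bsub>T\<^esub>} F T"
    using assms by (intro T.submoduleI') (auto simp: T.bracket_add_right T.bracket_smult_right)
  then have "square \<subseteq> {x \<in> carrier T. \<lblot>y, x\<rblot>\<^bsub>T\<^esub> = \<zero>\<^bsub>T\<^esub>}"
    unfolding square_def
    by (rule T.module_span_least) (use assms in \<open>auto simp: bracket_diagonal t_simps\<close>)
  then show yx: "\<lblot>y, x\<rblot>\<^bsub>T\<^esub> = \<zero>\<^bsub>T\<^esub>"
    using assms by blast
  then show "\<lblot>x, y\<rblot>\<^bsub>T\<^esub> = \<zero>\<^bsub>T\<^esub>"
    using assms square_carrier T.bracket_anticomm[of x y] by simp
qed

text \<open>Brackets with elements of \<open>square\<close> are zero, so closure under them amounts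
  to zero lying in the submodule.\<close>

lemma square_ideal: "algebra_ideal F T square"
  using square_submodule bracket_square T.submodule_zero[OF square_submodule]
  by unfold_locales (simp add: alg_ideal_def)

section \<open>The retraction onto the squares and the splitting\<close>

lemma bilinear_diagonal_square:
  "bilinear_diagonal F L T t (derived_subalgebra F L) square"
proof (intro bilinear_diagonal.intro bilinear_diagonal_axioms.intro)
  show "t w x \<oplus>\<^bsub>T\<^esub> t x w = \<zero>\<^bsub>T\<^esub>" if "w \<in> derived_subalgebra F L" "x \<in> carrier L" for w x
    using derived_radical(2)[OF that] by (simp add: polar_def)
qed (fact L.field_axioms L.is_module T.is_module t_bilinear L.derived_subalgebra_submodule
    square_submodule diagonal_in_square derived_radical(1))+

text \<open>The map \<open>h\<close> induced by B fixes each \<open>t l l\<close>, because B and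
  \<open>t\<close> share their diagonal; being linear, it fixes the span of these elements.\<close>

lemma square_retraction:
  assumes "fin_dim F (alg_quot L (derived_subalgebra F L))"
  obtains h where "h \<in> lin_maps F T T" "\<And>x. x \<in> carrier T \<Longrightarrow> h x \<in> square"
    "\<And>x. x \<in> square \<Longrightarrow> h x = x"
    "\<And>x y. \<lbrakk>x \<in> carrier T; y \<in> carrier T\<rbrakk> \<Longrightarrow> h \<lblot>x, y\<rblot>\<^bsub>T\<^esub> = \<zero>\<^bsub>T\<^esub>"
proof -
  interpret D: algebra_ideal F L "derived_subalgebra F L"
    by unfold_locales (rule L.derived_subalgebra_ideal)
  obtain X where "finite X" "X \<subseteq> carrier (alg_quot L (derived_subalgebra F L))"
    "module_span F (alg_quot L (derived_subalgebra F L)) X = carrier (alg_quot L (derived_subalgebra F L))"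
    using assms unfolding fin_dim_def by blast
  then obtain E where E: "finite E" "E \<subseteq> carrier L"
    "\<forall>U. submodule U F L \<and> derived_subalgebra F L \<union> E \<subseteq> U \<longrightarrow> U = carrier L"
    by (rule D.finite_quot_span_lift)
  interpret BD: bilinear_diagonal F L T t "derived_subalgebra F L" square
    by (rule bilinear_diagonal_square)
  obtain B where B: "B \<in> bilinear_maps F L (T\<lparr>carrier := square\<rparr>)"
    "\<forall>x\<in>carrier L. B x x = t x x"
    "\<forall>w\<in>derived_subalgebra F L. \<forall>x\<in>carrier L. B w x = \<zero>\<^bsub>T\<^esub> \<and> B x w = \<zero>\<^bsub>T\<^esub>"
    by (rule BD.bilinear_with_diagonal[OF E])
  note Bs = bilinear_mapsD[OF B(1), simplified]
  \<comment> \<open>The lifting property is stated for target \<open>T\<close>, so the smaller range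
    of B is forgotten here; that \<open>h\<close> maps into \<open>square\<close> is recovered
    below.\<close>
  have "B \<in> bilinear_maps F L T"
    by (rule bilinear_mapsI) (simp_all add: Bs square_carrier)
  then have "\<exists>h\<in>lin_maps F T T. (\<forall>l\<in>carrier L. \<forall>k\<in>carrier L. h (t l k) = B l k)
      \<and> (\<forall>x\<in>carrier T. \<forall>y\<in>carrier T. h \<lblot>x, y\<rblot>\<^bsub>T\<^esub> = \<zero>\<^bsub>T\<^esub>)"
    by (rule t_lift) (simp_all add: B(3))
  then obtain h where h: "h \<in> lin_maps F T T"
    "\<And>l k. \<lbrakk>l \<in> carrier L; k \<in> carrier L\<rbrakk> \<Longrightarrow> h (t l k) = B l k"
    "\<And>x y. \<lbrakk>x \<in> carrier T; y \<in> carrier T\<rbrakk> \<Longrightarrow> h \<lblot>x, y\<rblot>\<^bsub>T\<^esub> = \<zero>\<^bsub>T\<^esub>"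
    by auto
  note hs = lin_mapsD[OF h(1)]
  have h0: "h \<zero>\<^bsub>T\<^esub> = \<zero>\<^bsub>T\<^esub>"
    by (rule lin_maps_zero[OF T.is_module T.is_module h(1)])
  note sq = T.submoduleE(4,5)[OF square_submodule] T.submodule_zero[OF square_submodule]
  have "h x \<in> square" if "x \<in> carrier T" for x
  proof -
    \<comment> \<open>Tensors are sent to values of B, which lie in \<open>square\<close>, and
      brackets are sent to zero; hence this set is everything that the tensors generate.\<close>
    have "x \<in> {x \<in> carrier T. h x \<in> square}"
    proof (rule t_generates[OF _ _ _ that])
      show "submodule {x \<in> carrier T. h x \<in> square} F T"
        by (rule T.submoduleI') (auto simp: h0 hs sq)
    qed (auto simp: h sq Bs t_simps)
    then show ?thesis
      by simp
  qed
  moreover have "h x = x" if "x \<in> square" for x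
  proof -
    have "square \<subseteq> {x \<in> carrier T. h x = x}"
      unfolding square_def
    proof (rule T.module_span_least)
      show "submodule {x \<in> carrier T. h x = x} F T"
        by (rule T.submoduleI') (auto simp: h0 hs)
    qed (auto simp: h B(2) t_simps)
    then show ?thesis
      using that by blast
  qed
  ultimately show thesis
    using that[OF h(1)] h(3) by blast
qed

text \<open>The isomorphism pairs the coset of x with \<open>h x\<close>. It is injective because a
  difference lying in \<open>square\<close> is fixed by \<open>h\<close>. It respects brackets
  because in the second component both sides are zero.\<close>

lemma square_splits:
  assumes "fin_dim F (alg_quot L (derived_subalgebra F L))"
  shows "lie_isomorphic F T (lie_dirsum (alg_quot T square) (T\<lparr>carrier := square\<rparr>))"
proof -
  interpret S: algebra_ideal F T square
    by (rule square_ideal)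
  obtain h where h: "h \<in> lin_maps F T T" "\<And>x. x \<in> carrier T \<Longrightarrow> h x \<in> square"
    "\<And>x. x \<in> square \<Longrightarrow> h x = x"
    "\<And>x y. \<lbrakk>x \<in> carrier T; y \<in> carrier T\<rbrakk> \<Longrightarrow> h \<lblot>x, y\<rblot>\<^bsub>T\<^esub> = \<zero>\<^bsub>T\<^esub>"
    using square_retraction[OF assms] by blast
  note hs = lin_mapsD[OF h(1)]
  define \<Phi> where "\<Phi> x = (square +>\<^bsub>T\<^esub> x, h x)" for x
  have "inj_on \<Phi> (carrier T)"
  proof (rule inj_onI)
    fix x y assume xy: "x \<in> carrier T" "y \<in> carrier T" "\<Phi> x = \<Phi> y"
    then have "x \<ominus>\<^bsub>T\<^esub> y \<in> square" "h x = h y"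
      by (simp_all add: \<Phi>_def S.coset_eq_iff)
    then have "x \<ominus>\<^bsub>T\<^esub> y = h x \<ominus>\<^bsub>T\<^esub> h y"
      using xy h(3)[of "x \<ominus>\<^bsub>T\<^esub> y"] lin_maps_diff[OF T.is_module T.is_module h(1)] by simp
    then have "x \<ominus>\<^bsub>T\<^esub> y = \<zero>\<^bsub>T\<^esub>"
      using xy \<open>h x = h y\<close> hs(1) by (simp add: a_minus_def T.M.r_neg)
    then show "x = y"
      using xy T.diff_eq_zero_iff by blast
  qed
  moreover have "\<Phi> ` carrier T = carrier (alg_quot T square) \<times> square"
  proof
    show "\<Phi> ` carrier T \<subseteq> carrier (alg_quot T square) \<times> square"
      by (auto simp: \<Phi>_def h)
    show "carrier (alg_quot T square) \<times> square \<subseteq> \<Phi> ` carrier T"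
    proof clarify
      fix X s assume X: "X \<in> carrier (alg_quot T square)" and s: "s \<in> square"
      obtain y where y: "y \<in> carrier T" "X = square +>\<^bsub>T\<^esub> y"
        using X by (rule S.quot_carrierE)
      \<comment> \<open>The correction needed to reach (X, s): adding an element of
        \<open>square\<close> keeps the coset of \<open>y\<close>, and since \<open>h\<close> fixes
        \<open>d\<close> it moves the second component from \<open>h y\<close> to
        \<open>s\<close>.\<close>
      define d where "d = s \<ominus>\<^bsub>T\<^esub> h y"
      have d: "d \<in> square"
        using s y h(2) T.submodule_diff[OF square_submodule] by (simp add: d_def)
      have c: "d \<in> carrier T" "s \<in> carrier T" "h y \<in> carrier T"
        using d s y hs(1) square_carrier by auto
      have "(y \<oplus>\<^bsub>T\<^esub> d) \<ominus>\<^bsub>T\<^esub> y = d"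
        using y c by (simp add: T.add_diff_cancel)
      then have "square +>\<^bsub>T\<^esub> (y \<oplus>\<^bsub>T\<^esub> d) = X"
        using y c d by (simp add: S.coset_eq_iff)
      moreover have "h y \<oplus>\<^bsub>T\<^esub> d = s"
        using c by (simp add: d_def a_minus_def T.M.a_lcomm[of "h y" s] T.M.r_neg)
      then have "h (y \<oplus>\<^bsub>T\<^esub> d) = s"
        using y c d by (simp add: hs h(3))
      ultimately have "(X, s) = \<Phi> (y \<oplus>\<^bsub>T\<^esub> d)"
        by (simp add: \<Phi>_def)
      then show "(X, s) \<in> \<Phi> ` carrier T"
        using y c by blast
    qed
  qed
  ultimately have "\<Phi> \<in> lie_iso F T (lie_dirsum (alg_quot T square) (T\<lparr>carrier := square\<rparr>))"
    unfolding lie_iso_def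
    by (auto simp: bij_betw_def lie_dirsum_sel \<Phi>_def S.quot_ops hs h bracket_square)
  then show ?thesis
    unfolding lie_isomorphic_def by blast
qed

end


section \<open>Presented Lie algebras and the tensor square\<close>

context field
begin

lemma presentation_ideal:
  assumes "E \<subseteq> carrier (free_alg R S) \<times> carrier (free_alg R S)"
  shows "algebra_ideal R (free_alg R S) (presentation_ideal R S E)"
    and "x \<in> carrier (free_alg R S) \<Longrightarrow>
      x \<otimes>\<^bsub>free_alg R S\<^esub> x \<in> presentation_ideal R S E"
    and "\<lbrakk>x \<in> carrier (free_alg R S); y \<in> carrier (free_alg R S); z \<in> carrier (free_alg R S)\<rbrakk> \<Longrightarrow>
      x \<otimes>\<^bsub>free_alg R S\<^esub> (y \<otimes>\<^bsub>free_alg R S\<^esub> z)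
      \<oplus>\<^bsub>free_alg R S\<^esub> y \<otimes>\<^bsub>free_alg R S\<^esub> (z \<otimes>\<^bsub>free_alg R S\<^esub> x)
      \<oplus>\<^bsub>free_alg R S\<^esub> z \<otimes>\<^bsub>free_alg R S\<^esub> (x \<otimes>\<^bsub>free_alg R S\<^esub> y) \<in> presentation_ideal R S E"
    and "(u, v) \<in> E \<Longrightarrow> u \<ominus>\<^bsub>free_alg R S\<^esub> v \<in> presentation_ideal R S E"
proof -
  interpret A: nonassoc_algebra R "free_alg R S"
    by (rule free_alg_algebra)
  let ?X = "lie_identities (free_alg R S) \<union> {u \<ominus>\<^bsub>free_alg R S\<^esub> v | u v. (u, v) \<in> E}"
  have "?X \<subseteq> carrier (free_alg R S)"
    using assms by (auto simp: lie_identities_def)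
  then show "algebra_ideal R (free_alg R S) (presentation_ideal R S E)"
    unfolding presentation_ideal_def by unfold_locales (rule A.gen_ideal_is_ideal)
  have X: "?X \<subseteq> presentation_ideal R S E"
    unfolding presentation_ideal_def by (rule A.gen_ideal_incl)
  show "x \<otimes>\<^bsub>free_alg R S\<^esub> x \<in> presentation_ideal R S E" if "x \<in> carrier (free_alg R S)"
    by (rule subsetD[OF X]) (use that in \<open>auto simp: lie_identities_def\<close>)
  show "x \<otimes>\<^bsub>free_alg R S\<^esub> (y \<otimes>\<^bsub>free_alg R S\<^esub> z)
      \<oplus>\<^bsub>free_alg R S\<^esub> y \<otimes>\<^bsub>free_alg R S\<^esub> (z \<otimes>\<^bsub>free_alg R S\<^esub> x)
      \<oplus>\<^bsub>free_alg R S\<^esub> z \<otimes>\<^bsub>free_alg R S\<^esub> (x \<otimes>\<^bsub>free_alg R S\<^esub> y) \<in> presentation_ideal R S E"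
    if "x \<in> carrier (free_alg R S)" "y \<in> carrier (free_alg R S)" "z \<in> carrier (free_alg R S)"
    by (rule subsetD[OF X]) (use that in \<open>unfold lie_identities_def, blast\<close>)
  show "u \<ominus>\<^bsub>free_alg R S\<^esub> v \<in> presentation_ideal R S E" if "(u, v) \<in> E"
    by (rule subsetD[OF X]) (use that in blast)
qed

text \<open>The Lie identities were imposed on all elements of the free algebra and not merely on
  its generators, so they pass to arbitrary cosets directly.\<close>

lemma presented_lie_algebra:
  assumes E: "E \<subseteq> carrier (free_alg R S) \<times> carrier (free_alg R S)"
  shows "lie_algebra R (presented_lie_algebra R S E)"
proof -
  interpret I: algebra_ideal R "free_alg R S" "presentation_ideal R S E"
    by (rule presentation_ideal(1)[OF E])
  interpret Q: nonassoc_algebra R "presented_lie_algebra R S E"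
    unfolding presented_lie_algebra_def by (rule I.quot_algebra)
  show ?thesis
  proof
    fix X assume "X \<in> carrier (presented_lie_algebra R S E)"
    then obtain x where "x \<in> carrier (free_alg R S)" "X = presentation_ideal R S E +>\<^bsub>free_alg R S\<^esub> x"
      unfolding presented_lie_algebra_def by (rule I.quot_carrierE)
    then show "X \<otimes>\<^bsub>presented_lie_algebra R S E\<^esub> X = \<zero>\<^bsub>presented_lie_algebra R S E\<^esub>"
      using presentation_ideal(2)[OF E]
      by (simp add: presented_lie_algebra_def I.quot_ops alg_quot_sel(3) I.coset_eq_ideal_iff)
  next
    fix X Y Z assume "X \<in> carrier (presented_lie_algebra R S E)"
      "Y \<in> carrier (presented_lie_algebra R S E)" "Z \<in> carrier (presented_lie_algebra R S E)"
    then obtain x y z where "x \<in> carrier (free_alg R S)" "X = presentation_ideal R S E +>\<^bsub>free_alg R S\<^esub> x"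
      "y \<in> carrier (free_alg R S)" "Y = presentation_ideal R S E +>\<^bsub>free_alg R S\<^esub> y"
      "z \<in> carrier (free_alg R S)" "Z = presentation_ideal R S E +>\<^bsub>free_alg R S\<^esub> z"
      unfolding presented_lie_algebra_def by (elim I.quot_carrierE)
    then show "X \<otimes>\<^bsub>presented_lie_algebra R S E\<^esub> (Y \<otimes>\<^bsub>presented_lie_algebra R S E\<^esub> Z)
      \<oplus>\<^bsub>presented_lie_algebra R S E\<^esub> Y \<otimes>\<^bsub>presented_lie_algebra R S E\<^esub> (Z \<otimes>\<^bsub>presented_lie_algebra R S E\<^esub> X)
      \<oplus>\<^bsub>presented_lie_algebra R S E\<^esub> Z \<otimes>\<^bsub>presented_lie_algebra R S E\<^esub> (X \<otimes>\<^bsub>presented_lie_algebra R S E\<^esub> Y)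
      = \<zero>\<^bsub>presented_lie_algebra R S E\<^esub>"
      using presentation_ideal(3)[OF E]
      by (simp add: presented_lie_algebra_def I.quot_ops alg_quot_sel(3) I.coset_eq_ideal_iff)
  qed (simp_all add: Q.prod_add_left Q.prod_add_right Q.prod_smult_left Q.prod_smult_right)
qed

text \<open>Pulled back to the free algebra, \<open>H\<close> becomes a submodule that contains the
  generators and is closed under products, so \<open>free_alg_induct\<close> applies.\<close>

lemma presented_generates:
  assumes E: "E \<subseteq> carrier (free_alg R S) \<times> carrier (free_alg R S)"
    and H: "submodule H R (presented_lie_algebra R S E)"
    and gen: "\<And>x. x \<in> S \<Longrightarrow> presentation_ideal R S E +>\<^bsub>free_alg R S\<^esub> free_gen R x \<in> H"
    and mult: "\<And>x y. \<lbrakk>x \<in> H; y \<in> H\<rbrakk> \<Longrightarrow> x \<otimes>\<^bsub>presented_lie_algebra R S E\<^esub> y \<in> H"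
    and z: "z \<in> carrier (presented_lie_algebra R S E)"
  shows "z \<in> H"
proof -
  let ?A = "free_alg R S" and ?I = "presentation_ideal R S E"
  interpret I: algebra_ideal R ?A ?I
    by (rule presentation_ideal(1)[OF E])
  interpret Q: nonassoc_algebra R "alg_quot ?A ?I"
    by (rule I.quot_algebra)
  note H' = H[unfolded presented_lie_algebra_def] and mult' = mult[unfolded presented_lie_algebra_def]
  let ?K = "{f \<in> carrier ?A. ?I +>\<^bsub>?A\<^esub> f \<in> H}"
  have K: "submodule ?K R ?A"
  proof (rule I.submoduleI')
    show "\<zero>\<^bsub>?A\<^esub> \<in> ?K"
      using Q.submodule_zero[OF H'] by (simp add: I.quot_zero)
    show "f \<oplus>\<^bsub>?A\<^esub> g \<in> ?K" if "f \<in> ?K" "g \<in> ?K" for f g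
      using that Q.submoduleE(5)[OF H', of "?I +>\<^bsub>?A\<^esub> f" "?I +>\<^bsub>?A\<^esub> g"] by (simp add: I.quot_ops)
    show "c \<odot>\<^bsub>?A\<^esub> f \<in> ?K" if "c \<in> carrier R" "f \<in> ?K" for c f
      using that Q.submoduleE(4)[OF H', of c "?I +>\<^bsub>?A\<^esub> f"] by (simp add: I.quot_ops)
  qed auto
  obtain f where f: "f \<in> carrier ?A" "z = ?I +>\<^bsub>?A\<^esub> f"
    using z unfolding presented_lie_algebra_def by (rule I.quot_carrierE)
  have "f \<in> ?K"
  proof (rule free_alg_induct[OF K _ _ f(1)])
    show "free_gen R x \<in> ?K" if "x \<in> S" for x
      using that gen free_gen_closed by simp
    show "f \<otimes>\<^bsub>?A\<^esub> g \<in> ?K" if "f \<in> ?K" "g \<in> ?K" for f g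
      using that mult'[of "?I +>\<^bsub>?A\<^esub> f" "?I +>\<^bsub>?A\<^esub> g"] by (simp add: I.quot_ops)
  qed
  then show ?thesis
    using f by simp
qed

text \<open>A homomorphism into \<open>M\<close> with zero bracket is a linear map that kills
  products. Its kernel is therefore automatically an ideal containing the Lie identities, and only
  the relations in \<open>E\<close> remain. They are tested on an arbitrary such map, known by its
  values on generators and products.\<close>

lemma presented_abelian_lift:
  assumes E: "E \<subseteq> carrier (free_alg R S) \<times> carrier (free_alg R S)"
    and M: "module R M" and \<beta>: "\<And>x. x \<in> S \<Longrightarrow> \<beta> x \<in> carrier M"
    and rel: "\<And>h u v. \<lbrakk>h \<in> lin_maps R (free_alg R S) M; \<forall>x\<in>S. h (free_gen R x) = \<beta> x;
      \<forall>f g. h (f \<otimes>\<^bsub>free_alg R S\<^esub> g) = \<zero>\<^bsub>M\<^esub>; (u, v) \<in> E\<rbrakk> \<Longrightarrow> h u = h v"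
  obtains h where "h \<in> lin_maps R (presented_lie_algebra R S E) M"
    "\<forall>x\<in>S. h (presentation_ideal R S E +>\<^bsub>free_alg R S\<^esub> free_gen R x) = \<beta> x"
    "\<forall>x\<in>carrier (presented_lie_algebra R S E). \<forall>y\<in>carrier (presented_lie_algebra R S E).
      h (x \<otimes>\<^bsub>presented_lie_algebra R S E\<^esub> y) = \<zero>\<^bsub>M\<^esub>"
proof -
  let ?A = "free_alg R S" and ?I = "presentation_ideal R S E"
  interpret I: algebra_ideal R ?A ?I
    by (rule presentation_ideal(1)[OF E])
  interpret M: module R M by fact
  obtain h where h: "h \<in> lin_maps R ?A M" "\<forall>x\<in>S. h (free_gen R x) = \<beta> x"
    "\<forall>f g. h (f \<otimes>\<^bsub>?A\<^esub> g) = \<zero>\<^bsub>M\<^esub>"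
    by (rule free_alg_lift[OF M \<beta>])
  note hs = lin_mapsD[OF h(1)]
  have h0: "h \<zero>\<^bsub>?A\<^esub> = \<zero>\<^bsub>M\<^esub>"
    by (rule lin_maps_zero[OF I.is_module M h(1)])
  have K: "alg_ideal R ?A {f \<in> carrier ?A. h f = \<zero>\<^bsub>M\<^esub>}"
    unfolding alg_ideal_def
  proof (intro conjI ballI)
    show "submodule {f \<in> carrier ?A. h f = \<zero>\<^bsub>M\<^esub>} R ?A"
      by (rule I.submoduleI') (auto simp: h0 hs)
  qed (auto simp: h(3))
  have "?I \<subseteq> {f \<in> carrier ?A. h f = \<zero>\<^bsub>M\<^esub>}"
    unfolding presentation_ideal_def
  proof (rule I.gen_ideal_least[OF K], rule Un_least)
    show "lie_identities ?A \<subseteq> {f \<in> carrier ?A. h f = \<zero>\<^bsub>M\<^esub>}"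
      by (auto simp: lie_identities_def h(3) hs)
    show "{u \<ominus>\<^bsub>?A\<^esub> v | u v. (u, v) \<in> E} \<subseteq> {f \<in> carrier ?A. h f = \<zero>\<^bsub>M\<^esub>}"
    proof clarify
      fix u v assume uv: "(u, v) \<in> E"
      then have c: "u \<in> carrier ?A" "v \<in> carrier ?A"
        using E by auto
      have "h (u \<ominus>\<^bsub>?A\<^esub> v) = \<zero>\<^bsub>M\<^esub>"
        using rel[OF h uv] c lin_maps_diff[OF I.is_module M h(1)] hs(1)
        by (simp add: a_minus_def M.r_neg)
      then show "u \<ominus>\<^bsub>?A\<^esub> v \<in> carrier ?A \<and> h (u \<ominus>\<^bsub>?A\<^esub> v) = \<zero>\<^bsub>M\<^esub>"
        using c by simp
    qed
  qed
  then have ker: "h x = \<zero>\<^bsub>M\<^esub>" if "x \<in> ?I" for x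
    using that by blast
  obtain g where g: "g \<in> lin_maps R (alg_quot ?A ?I) M" "\<forall>x\<in>carrier ?A. g (?I +>\<^bsub>?A\<^esub> x) = h x"
    by (rule I.quot_lift[OF M h(1) ker])
  have "g (x \<otimes>\<^bsub>alg_quot ?A ?I\<^esub> y) = \<zero>\<^bsub>M\<^esub>"
    if "x \<in> carrier (alg_quot ?A ?I)" "y \<in> carrier (alg_quot ?A ?I)" for x y
    using that by (elim I.quot_carrierE) (simp add: I.quot_ops g(2) h(3))
  moreover have "g (?I +>\<^bsub>?A\<^esub> free_gen R x) = \<beta> x" if "x \<in> S" for x
    using g(2) h(2) free_gen_closed[OF that] that by simp
  ultimately show thesis
    using that[of g] g(1) unfolding presented_lie_algebra_def by blast
qed

end

section \<open>The tensor square as a crossed pairing\<close>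

context lie_algebra
begin

lemma tensor_relations_carrier:
  "tensor_relations F L \<subseteq> carrier (free_alg F (carrier L \<times> carrier L)) \<times> carrier (free_alg F (carrier L \<times> carrier L))"
proof -
  interpret A: nonassoc_algebra F "free_alg F (carrier L \<times> carrier L)"
    by (rule F.free_alg_algebra)
  show ?thesis
    unfolding tensor_relations_def Let_def by (auto intro!: F.free_gen_closed)
qed

lemma tensor_square_pairing: "tensor_pairing F L (tensor_square F L) (tensor F L)"
proof -
  let ?S = "carrier L \<times> carrier L"
  let ?A = "free_alg F ?S" and ?E = "tensor_relations F L"
  let ?I = "presentation_ideal F ?S ?E"
  let ?T = "alg_quot ?A ?I"
  let ?t = "\<lambda>l k. ?I +>\<^bsub>?A\<^esub> free_gen F (l, k)"
  note E = tensor_relations_carrier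
  interpret I: algebra_ideal F ?A ?I
    by (rule F.presentation_ideal(1)[OF E])
  interpret T: lie_algebra F ?T
    using F.presented_lie_algebra[OF E] by (simp add: presented_lie_algebra_def)
  have G [simp]: "free_gen F (l, k) \<in> carrier ?A" if "l \<in> carrier L" "k \<in> carrier L" for l k
    using that by (simp add: F.free_gen_closed)
  have rel: "?I +>\<^bsub>?A\<^esub> u = ?I +>\<^bsub>?A\<^esub> v" if "(u, v) \<in> ?E" for u v
    using that E F.presentation_ideal(4)[OF E that] by (subst I.coset_eq_iff) auto
  have \<pi>: "(\<lambda>f. ?I +>\<^bsub>?A\<^esub> f) \<in> lin_maps F ?A ?T"
    by (simp add: lin_maps_def I.quot_ops)
  note \<pi>_minus = lin_maps_minus[OF I.is_module T.is_module \<pi>, symmetric]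
    and \<pi>_diff = lin_maps_diff[OF I.is_module T.is_module \<pi>, symmetric]
  \<comment> \<open>The union of the seven families of relations nests to the left; the position of
    a family fixes its chain of \<open>UnI1\<close> and \<open>UnI2\<close>.\<close>
  have mem1: "(c \<odot>\<^bsub>?A\<^esub> free_gen F (l, k), free_gen F (c \<odot>\<^bsub>L\<^esub> l, k)) \<in> ?E"
    if "c \<in> carrier F" "l \<in> carrier L" "k \<in> carrier L" for c l k
    unfolding tensor_relations_def Let_def
    by (rule UnI1, rule UnI1, rule UnI1, rule UnI1, rule UnI1, rule UnI1, use that in blast)
  have mem2: "(c \<odot>\<^bsub>?A\<^esub> free_gen F (l, k), free_gen F (l, c \<odot>\<^bsub>L\<^esub> k)) \<in> ?E"
    if "c \<in> carrier F" "l \<in> carrier L" "k \<in> carrier L" for c l k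
    unfolding tensor_relations_def Let_def
    by (rule UnI1, rule UnI1, rule UnI1, rule UnI1, rule UnI1, rule UnI2, use that in blast)
  have mem3: "(free_gen F (l \<oplus>\<^bsub>L\<^esub> l', k), free_gen F (l, k) \<oplus>\<^bsub>?A\<^esub> free_gen F (l', k)) \<in> ?E"
    if "l \<in> carrier L" "l' \<in> carrier L" "k \<in> carrier L" for l l' k
    unfolding tensor_relations_def Let_def
    by (rule UnI1, rule UnI1, rule UnI1, rule UnI1, rule UnI2, use that in blast)
  have mem4: "(free_gen F (l, k \<oplus>\<^bsub>L\<^esub> k'), free_gen F (l, k) \<oplus>\<^bsub>?A\<^esub> free_gen F (l, k')) \<in> ?E"
    if "l \<in> carrier L" "k \<in> carrier L" "k' \<in> carrier L" for l k k'
    unfolding tensor_relations_def Let_def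
    by (rule UnI1, rule UnI1, rule UnI1, rule UnI2, use that in blast)
  have mem5: "(free_gen F (\<lblot>l, l'\<rblot>\<^bsub>L\<^esub>, k),
        free_gen F (l, \<lblot>l', k\<rblot>\<^bsub>L\<^esub>) \<ominus>\<^bsub>?A\<^esub> free_gen F (l', \<lblot>l, k\<rblot>\<^bsub>L\<^esub>)) \<in> ?E"
    if "l \<in> carrier L" "l' \<in> carrier L" "k \<in> carrier L" for l l' k
    unfolding tensor_relations_def Let_def
    by (rule UnI1, rule UnI1, rule UnI2, use that in blast)
  have mem6: "(free_gen F (l, \<lblot>k, k'\<rblot>\<^bsub>L\<^esub>),
        free_gen F (\<lblot>k', l\<rblot>\<^bsub>L\<^esub>, k) \<ominus>\<^bsub>?A\<^esub> free_gen F (\<lblot>k, l\<rblot>\<^bsub>L\<^esub>, k')) \<in> ?E"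
    if "l \<in> carrier L" "k \<in> carrier L" "k' \<in> carrier L" for l k k'
    unfolding tensor_relations_def Let_def
    by (rule UnI1, rule UnI2, use that in blast)
  have mem7: "(\<lblot>free_gen F (l, k), free_gen F (l', k')\<rblot>\<^bsub>?A\<^esub>,
        \<ominus>\<^bsub>?A\<^esub> free_gen F (\<lblot>k, l\<rblot>\<^bsub>L\<^esub>, \<lblot>l', k'\<rblot>\<^bsub>L\<^esub>)) \<in> ?E"
    if "l \<in> carrier L" "k \<in> carrier L" "l' \<in> carrier L" "k' \<in> carrier L" for l k l' k'
    unfolding tensor_relations_def Let_def
    by (rule UnI2, use that in blast)
  \<comment> \<open>The scalar relations are reversed because their left-hand side is the scaled
    tensor, whereas \<open>bilinear_maps\<close> has it on the right.\<close>
  have bil: "?t \<in> bilinear_maps F L ?T"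
    by (rule bilinear_mapsI)
      (simp_all add: I.quot_ops rel[OF mem1, symmetric] rel[OF mem2, symmetric]
        rel[OF mem3] rel[OF mem4])
  have "tensor_pairing F L ?T ?t"
  proof (unfold_locales, goal_cases)
    case 1
    then show ?case
      by (rule bil)
  next
    case (2 l l' k)
    then show ?case
      by (simp add: rel[OF mem5] \<pi>_diff)
  next
    case (3 l k k')
    then show ?case
      by (simp add: rel[OF mem6] \<pi>_diff)
  next
    case (4 l k l' k')
    then show ?case
      by (simp add: I.quot_ops rel[OF mem7] \<pi>_minus)
  next
    case (5 H z)
    show ?case
      by (rule F.presented_generates[OF E, unfolded presented_lie_algebra_def, of H z])
        (use 5 in auto)
  next
    case (6 B)
    note Bs = bilinear_mapsD[OF 6(1)]
    have "h u = h v"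
      if h: "h \<in> lin_maps F ?A ?T" "\<forall>x\<in>?S. h (free_gen F x) = case_prod B x"
        "\<forall>f g. h (f \<otimes>\<^bsub>?A\<^esub> g) = \<zero>\<^bsub>?T\<^esub>" and uv: "(u, v) \<in> ?E" for h u v
    proof -
      have hG: "h (free_gen F (l, k)) = B l k" if "l \<in> carrier L" "k \<in> carrier L" for l k
        using that h(2) by simp
      have minus_zero: "\<ominus>\<^bsub>?T\<^esub> \<zero>\<^bsub>?T\<^esub> = \<zero>\<^bsub>?T\<^esub>"
        by (rule T.M.minus_equality) simp_all
      note hs = lin_mapsD(2,3)[OF h(1)]
        lin_maps_minus[OF I.is_module T.is_module h(1)] lin_maps_diff[OF I.is_module T.is_module h(1)]
      show ?thesis
        \<comment> \<open>The linear relations follow from bilinearity of B. In the crossed and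
          product relations every term is either \<open>h\<close> of a product or a value of B with
          a bracket as an argument, so both sides are zero.\<close>
        using uv unfolding tensor_relations_def Let_def
        by (auto simp: hs hG h(3) Bs 6(2,3) bracket_in_derived a_minus_def minus_zero)
    qed
    note rel_B = this
    have "case_prod B x \<in> carrier ?T" if "x \<in> ?S" for x
      using that Bs(1) by auto
    then obtain h where "h \<in> lin_maps F ?T ?T"
      "\<forall>x\<in>?S. h (?I +>\<^bsub>?A\<^esub> free_gen F x) = case_prod B x"
      "\<forall>x\<in>carrier ?T. \<forall>y\<in>carrier ?T. h (x \<otimes>\<^bsub>?T\<^esub> y) = \<zero>\<^bsub>?T\<^esub>"
      by (rule F.presented_abelian_lift[OF E T.is_module _ rel_B, unfolded presented_lie_algebra_def])
    then show ?case
      by (intro bexI[of _ h]) auto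
  qed
  then show ?thesis
    by (simp add: tensor_square_def presented_lie_algebra_def tensor_def[abs_def])
qed

end

theorem theorem2p5:
  fixes F :: "('a, 'm) ring_scheme" and L :: "('a, 'b, 'n) module_scheme"
  assumes "lie_algebra F L"
    and "fin_dim F (alg_quot L (derived_subalgebra F L))"
  shows "lie_isomorphic F (tensor_square F L)
    (lie_dirsum (exterior_square F L) ((tensor_square F L)\<lparr>carrier := square_ideal F L\<rparr>))"
proof -
  interpret tensor_pairing F L "tensor_square F L" "tensor F L"
    by (rule lie_algebra.tensor_square_pairing[OF assms(1)])
  \<comment> \<open>For this pairing \<open>square\<close> unfolds to \<open>square_ideal\<close>,
    and the quotient by it to \<open>exterior_square\<close>.\<close>
  show ?thesis
    using square_splits[OF assms(2)]
    by (simp add: square_def exterior_square_def square_ideal_def[abs_def])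
qed

end
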